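(* Let $G$ be a finite or infinite connected graph with maximum valence 3. If $G$ has a vertex of valence 2 of type 2 but no vertex of valence 2 of type 1, then $G$ is isomorphic to $K_{2,3}$ or to $R^1_n$ for some $n$, or $D(G)\le 2$.
   Context: For a vertex $v$, the stabilizer $\mathrm{Aut}_v(G)$ induces a permutation group on the neighbors of $v$; the type of $v$ is its order (for valence 2: type 1 if trivial, type 2 if it swaps the two neighbors). $D(G)$ is the least number of colors in a vertex coloring of $G$ whose only color-preserving automorphism is the identity. For $n\ge1$, $T_n$ is the finite tree in which every vertex has valence 1 or 3 and every leaf has distance exactly $n$ from a fixed root. $R^1_n$ is obtained from $T_n$ by, for every pair of leaves $u,v$ with a common neighbor, adding two new vertices $x,y$ and edges $ux,xv,vy,yu$. *)

theory Defs
  imports Complex_Main "HOL-Library.FuncSet" "HOL-Library.Extended_Nat"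
begin

record 'a sgraph =
  verts :: "'a set"
  edges :: "'a set set"

definition simple_graph :: "'a sgraph \<Rightarrow> bool" where
  "simple_graph G \<longleftrightarrow> (\<forall>e\<in>edges G. e \<subseteq> verts G \<and> card e = 2)"

definition neighbors :: "'a sgraph \<Rightarrow> 'a \<Rightarrow> 'a set" where
  "neighbors G v = {w \<in> verts G. {v, w} \<in> edges G}"

text \<open>Only meaningful for vertices with finitely many neighbors; \<open>max_valence\<close> below
  demands finiteness explicitly.\<close>

definition valence :: "'a sgraph \<Rightarrow> 'a \<Rightarrow> nat" where
  "valence G v = card (neighbors G v)"

definition max_valence :: "'a sgraph \<Rightarrow> nat \<Rightarrow> bool" where
  "max_valence G k \<longleftrightarrow>
     (\<forall>v\<in>verts G. finite (neighbors G v) \<and> valence G v \<le> k) \<and>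
     (\<exists>v\<in>verts G. valence G v = k)"

definition walk :: "'a sgraph \<Rightarrow> 'a list \<Rightarrow> bool" where
  "walk G xs \<longleftrightarrow>
     xs \<noteq> [] \<and> set xs \<subseteq> verts G \<and> successively (\<lambda>u v. {u, v} \<in> edges G) xs"

definition connected_graph :: "'a sgraph \<Rightarrow> bool" where
  "connected_graph G \<longleftrightarrow> verts G \<noteq> {} \<and>
     (\<forall>u\<in>verts G. \<forall>v\<in>verts G. \<exists>xs. walk G xs \<and> hd xs = u \<and> last xs = v)"

definition graph_dist :: "'a sgraph \<Rightarrow> 'a \<Rightarrow> 'a \<Rightarrow> nat" where
  "graph_dist G u v =
     (LEAST k. \<exists>xs. walk G xs \<and> hd xs = u \<and> last xs = v \<and> length xs = Suc k)"

definition graph_cycle :: "'a sgraph \<Rightarrow> 'a list \<Rightarrow> bool" where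
  "graph_cycle G xs \<longleftrightarrow>
     walk G xs \<and> distinct xs \<and> 3 \<le> length xs \<and> {last xs, hd xs} \<in> edges G"

definition tree :: "'a sgraph \<Rightarrow> bool" where
  "tree G \<longleftrightarrow> simple_graph G \<and> connected_graph G \<and> (\<nexists>xs. graph_cycle G xs)"

definition graph_iso :: "'a sgraph \<Rightarrow> 'b sgraph \<Rightarrow> ('a \<Rightarrow> 'b) \<Rightarrow> bool" where
  "graph_iso G H f \<longleftrightarrow> bij_betw f (verts G) (verts H) \<and>
     (\<forall>u\<in>verts G. \<forall>v\<in>verts G. {u, v} \<in> edges G \<longleftrightarrow> {f u, f v} \<in> edges H)"

definition isomorphic :: "'a sgraph \<Rightarrow> 'b sgraph \<Rightarrow> bool" where
  "isomorphic G H \<longleftrightarrow> (\<exists>f. graph_iso G H f)"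

text \<open>Automorphisms are functions on the whole type, of which only the values on
  \<open>verts G\<close> matter; statements about them are relativised to \<open>verts G\<close>.\<close>

definition automorphism :: "'a sgraph \<Rightarrow> ('a \<Rightarrow> 'a) \<Rightarrow> bool" where
  "automorphism G f \<longleftrightarrow> graph_iso G G f"

definition stabilizer :: "'a sgraph \<Rightarrow> 'a \<Rightarrow> ('a \<Rightarrow> 'a) set" where
  "stabilizer G v = {f. automorphism G f \<and> f v = v}"

definition vertex_type :: "'a sgraph \<Rightarrow> 'a \<Rightarrow> nat" where
  "vertex_type G v = card ((\<lambda>f. restrict f (neighbors G v)) ` stabilizer G v)"

definition distinguishing :: "'a sgraph \<Rightarrow> ('a \<Rightarrow> nat) \<Rightarrow> bool" where
  "distinguishing G c \<longleftrightarrow>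
     (\<forall>f. automorphism G f \<longrightarrow> (\<forall>v\<in>verts G. c (f v) = c v) \<longrightarrow> (\<forall>v\<in>verts G. f v = v))"

text \<open>The value is \<open>\<infinity>\<close> if no finite number of colors suffices.\<close>

definition distinguishing_number :: "'a sgraph \<Rightarrow> enat" where
  "distinguishing_number G =
     Inf {enat k | k. \<exists>c. c ` verts G \<subseteq> {..<k} \<and> distinguishing G c}"

definition complete_bipartite :: "nat \<Rightarrow> nat \<Rightarrow> (nat + nat) sgraph" where
  "complete_bipartite m n =
     \<lparr> verts = Inl ` {..<m} \<union> Inr ` {..<n},
       edges = {{Inl i, Inr j} | i j. i < m \<and> j < n} \<rparr>"

definition leaves :: "'a sgraph \<Rightarrow> 'a set" where
  "leaves G = {v \<in> verts G. valence G v = 1}"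

text \<open>\<open>T\<close> is a copy of the tree \<open>T\<^sub>n\<close>, which is determined by this property up to isomorphism.\<close>

definition is_T :: "nat \<Rightarrow> 'a sgraph \<Rightarrow> bool" where
  "is_T n T \<longleftrightarrow> tree T \<and> finite (verts T) \<and>
     (\<forall>v\<in>verts T. valence T v = 1 \<or> valence T v = 3) \<and>
     (\<exists>r\<in>verts T. \<forall>v\<in>leaves T. graph_dist T r v = n)"

definition leaf_pairs :: "'a sgraph \<Rightarrow> 'a set set" where
  "leaf_pairs T = {{u, v} | u v. u \<in> leaves T \<and> v \<in> leaves T \<and> u \<noteq> v \<and>
     neighbors T u \<inter> neighbors T v \<noteq> {}}"

text \<open>The two new vertices for a pair \<open>p = {u, v}\<close> of leaves are \<open>Inr (p, False)\<close> and
  \<open>Inr (p, True)\<close>; each of them is joined to \<open>u\<close> and \<open>v\<close>.\<close>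

definition R1_of :: "'a sgraph \<Rightarrow> ('a + 'a set \<times> bool) sgraph" where
  "R1_of T =
     \<lparr> verts = Inl ` verts T \<union> Inr ` (leaf_pairs T \<times> UNIV),
       edges = (`) Inl ` edges T \<union>
               {{Inl u, Inr (p, b)} | u p b. p \<in> leaf_pairs T \<and> u \<in> p} \<rparr>"

text \<open>The underlying tree is taken on the vertex type \<open>nat\<close>; since it is finite, this is no
  restriction up to isomorphism.\<close>

definition isomorphic_R1 :: "'a sgraph \<Rightarrow> nat \<Rightarrow> bool" where
  "isomorphic_R1 G n \<longleftrightarrow> (\<exists>T :: nat sgraph. is_T n T \<and> isomorphic G (R1_of T))"

end

theory Submission
  imports Defs
begin

text \<open>If an automorphism fixes two adjacent vertices \<open>a\<close> and \<open>b\<close>, then, growing the set of fixed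
  vertices one neighborhood at a time, each fixed vertex has at most two new neighbors; giving these
  different colors fixes everything. This leaves enough freedom to make the root \<open>(a, b)\<close>
  recognizable by its colors. Type 2 forces the neighbors of valence-2 vertices to have valence 3, so
  these vertices can be suppressed, except that twins (valence-2 vertices with the same neighbors) get
  different colors; three vertices with the same neighbors give \<open>K\<^bsub>2,3\<^esub>\<close>.

  If some valence-2 vertex \<open>z\<close> has no twin, the root consists of the neighbors of \<open>z\<close>, and \<open>z\<close> is the
  only twinless valence-2 vertex of its color. If the common neighbors \<open>u, v\<close> of some twins have no
  further common neighbor, they are the root: \<open>u, v\<close> get different colors, and all other such pairs
  are monochromatic. Otherwise all twins sit in pendant 4-cycles, which act as marked leaves of the
  remaining graph, all of whose valences are 1 or 3. Consider complete binary branches with all leaves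
  marked. If one of them does not extend to a larger one, its top is made the only one of its rank and
  color and serves as root. If all of them extend, either forever, then the graph is an infinite
  canopy tree, or until three equal branches meet in one vertex, and \<open>G\<close> is \<open>R\<^sup>1\<^sub>n\<close>.\<close>

subsection \<open>Colorings grown from an edge\<close>

text \<open>Zorn's lemma for partial colorings \<open>(S, c)\<close>. A total \<open>c\<close>
  carries arbitrary values outside \<open>S\<close>, so each pair is replaced by the graph of
  \<open>c\<close> on \<open>S\<close>, for which extension is plain inclusion; \<open>local\<close>
  says that \<open>Good\<close> sees nothing else. In \<open>chain\<close> one \<open>c\<close>
  serves all members because the colorings of a chain are glued first.\<close>

lemma greedy_extension:
  fixes Good :: "'a set \<Rightarrow> ('a \<Rightarrow> 'b) \<Rightarrow> bool"
  assumes base: "Good S\<^sub>0 c\<^sub>0"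
    and local: "\<And>S c c'. Good S c \<Longrightarrow> (\<And>x. x \<in> S \<Longrightarrow> c' x = c x) \<Longrightarrow> Good S c'"
    and chain: "\<And>\<C> c. \<C> \<noteq> {} \<Longrightarrow> subset.chain {S. Good S c} \<C> \<Longrightarrow> Good (\<Union>\<C>) c"
    and ext: "\<And>S c. Good S c \<Longrightarrow> S \<noteq> V \<Longrightarrow>
      \<exists>S' c'. S \<subset> S' \<and> Good S' c' \<and> (\<forall>x\<in>S. c' x = c x)"
  shows "\<exists>c. Good V c"
proof -
  define gr :: "'a set \<Rightarrow> ('a \<Rightarrow> 'b) \<Rightarrow> ('a \<times> 'b) set" where "gr S c = (\<lambda>x. (x, c x)) ` S" for S c
  have dom: "fst ` gr S c = S" for S c by (force simp: gr_def)
  have val: "(x, y) \<in> gr S c \<longleftrightarrow> x \<in> S \<and> y = c x" for x y S c by (auto simp: gr_def)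
  define A where "A = {r. \<exists>S c. r = gr S c \<and> Good S c}"
  have A_I: "gr S c \<in> A" if "Good S c" for S c using that unfolding A_def by blast
  have A_E: "\<exists>S c. r = gr S c \<and> Good S c" if "r \<in> A" for r using that by (simp add: A_def)
  have "\<exists>M\<in>A. \<forall>r\<in>A. M \<subseteq> r \<longrightarrow> r = M"
  proof (rule subset_Zorn_nonempty)
    show "A \<noteq> {}" using A_I[OF base] by blast
  next
    fix \<C> assume ne: "\<C> \<noteq> {}" and ch: "subset.chain A \<C>"
    \<comment> \<open>The glued coloring: by \<open>sv\<close> the union is single-valued, so the
      choice is forced on its domain and arbitrary elsewhere.\<close>
    define c where "c x = (SOME y. (x, y) \<in> \<Union>\<C>)" for x
    have good: "r \<in> A" if "r \<in> \<C>" for r using ch that by (auto simp: subset.chain_def)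
    have lin: "r \<subseteq> s \<or> s \<subseteq> r" if "r \<in> \<C>" "s \<in> \<C>" for r s
      using ch that unfolding subset.chain_def by blast
    have sv: "y = z" if xy: "(x, y) \<in> \<Union>\<C>" "(x, z) \<in> \<Union>\<C>" for x y z
    proof -
      obtain r s where "r \<in> \<C>" "s \<in> \<C>" "(x, y) \<in> r" "(x, z) \<in> s"
        using xy by (elim UnionE)
      then obtain t where "t \<in> \<C>" "(x, y) \<in> t" "(x, z) \<in> t" using lin by blast
      moreover obtain S d where "t = gr S d" using A_E[OF good[OF \<open>t \<in> \<C>\<close>]] by auto
      ultimately show ?thesis by (simp add: val)
    qed
    have c: "c x = y" if "(x, y) \<in> \<Union>\<C>" for x y
      unfolding c_def using sv that by blast
    have rep: "Good (fst ` r) c \<and> r = gr (fst ` r) c" if r: "r \<in> \<C>" for r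
    proof -
      obtain S d where Sd: "r = gr S d" "Good S d" using A_E[OF good[OF r]] by auto
      have eq: "c x = d x" if "x \<in> S" for x
        using c r that Sd(1) val by (metis UnionI)
      have "Good S c" using local[OF Sd(2)] eq by blast
      moreover have "r = gr S c" using eq Sd(1) by (auto simp: gr_def)
      ultimately show ?thesis by (simp add: dom)
    qed
    have "subset.chain {S. Good S c} ((`) fst ` \<C>)"
      unfolding subset.chain_def using rep lin by (blast intro: image_mono)
    hence 1: "Good (\<Union>((`) fst ` \<C>)) c" by (intro chain) (use ne in auto)
    have 2: "\<Union>\<C> = gr (\<Union>((`) fst ` \<C>)) c"
    proof -
      have "\<Union>\<C> = (\<Union>r\<in>\<C>. r)" by simp
      also have "\<dots> = (\<Union>r\<in>\<C>. gr (fst ` r) c)"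
        by (rule SUP_cong[OF refl]) (rule conjunct2[OF rep])
      also have "\<dots> = gr (\<Union>((`) fst ` \<C>)) c" unfolding gr_def by blast
      finally show ?thesis .
    qed
    show "\<Union>\<C> \<in> A"
      unfolding 2 by (rule A_I[OF 1])
  qed
  then obtain r where r: "r \<in> A" and max: "\<And>r'. r' \<in> A \<Longrightarrow> r \<subseteq> r' \<Longrightarrow> r' = r" by blast
  obtain S c where Sc: "r = gr S c" "Good S c" using A_E[OF r] by auto
  have "S = V"
  proof (rule ccontr)
    assume "S \<noteq> V"
    then obtain S' c' where *: "S \<subset> S'" "Good S' c'" "\<forall>x\<in>S. c' x = c x" using ext[OF Sc(2)] by metis
    have "gr S c \<subseteq> gr S' c'" using * by (auto simp: gr_def)
    moreover have "gr S' c' \<in> A" by (rule A_I[OF *(2)])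
    ultimately have "gr S' c' = gr S c" using max Sc(1) by simp
    hence "S' = S" by (metis dom)
    thus False using * by blast
  qed
  thus ?thesis using Sc(2) by auto
qed

text \<open>\<open>nb\<close> is kept abstract because it will be the adjacency of auxiliary graphs
  on the vertices of valence other than 2 (\<open>nbH\<close> and \<open>nb3\<close>), while
  \<open>\<Gamma>\<close> remains the set of automorphisms of the original graph. Connectedness
  takes the form that only \<open>V\<close> is nonempty and closed under \<open>nb\<close>.\<close>

locale nbr_graph =
  fixes V :: "'a set" and nb :: "'a \<Rightarrow> 'a set" and \<Gamma> :: "('a \<Rightarrow> 'a) set"
  assumes nb_subset: "x \<in> V \<Longrightarrow> nb x \<subseteq> V"
    and nb_sym: "x \<in> V \<Longrightarrow> y \<in> nb x \<Longrightarrow> x \<in> nb y"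
    and nb_finite: "x \<in> V \<Longrightarrow> finite (nb x)"
    and nb_card: "x \<in> V \<Longrightarrow> card (nb x) \<le> 3"
    and nb_connected: "S \<subseteq> V \<Longrightarrow> S \<noteq> {} \<Longrightarrow> (\<And>x. x \<in> S \<Longrightarrow> nb x \<subseteq> S) \<Longrightarrow> S = V"
    and aut_closed: "f \<in> \<Gamma> \<Longrightarrow> x \<in> V \<Longrightarrow> f x \<in> V"
    and aut_inj: "f \<in> \<Gamma> \<Longrightarrow> inj_on f V"
    and aut_nb: "f \<in> \<Gamma> \<Longrightarrow> x \<in> V \<Longrightarrow> nb (f x) = f ` nb x"
begin

text \<open>\<open>D\<close> holds the vertices with prescribed colors \<open>g\<close>. If all of
  \<open>N\<close> is prescribed, \<open>swap\<close> separates whatever could be moved; otherwise a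
  free vertex \<open>w\<close> gets the color opposite to that of the other one.\<close>

lemma color_new_neighbours:
  fixes g :: "'a \<Rightarrow> bool"
  assumes p: "p \<in> V" and N: "N \<subseteq> nb p" "finite N" "card N \<le> 2"
    and swap: "\<And>w w' f. w \<in> N \<inter> D \<Longrightarrow> w' \<in> N \<inter> D \<Longrightarrow> w \<noteq> w' \<Longrightarrow> f \<in> \<Gamma> \<Longrightarrow> f p = p \<Longrightarrow>
      f w = w' \<Longrightarrow> g w \<noteq> g w'"
  shows "\<exists>d. (\<forall>x\<in>N \<inter> D. d x = g x) \<and>
    (\<forall>f\<in>\<Gamma>. f p = p \<longrightarrow> (\<forall>x\<in>N. f x \<in> N \<and> d (f x) = d x) \<longrightarrow> (\<forall>x\<in>N. f x = x))"
proof -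
  consider "N \<subseteq> D" | w where "w \<in> N" "w \<notin> D" by blast
  thus ?thesis
  proof cases
    case 1
    have "f x = x" if "f \<in> \<Gamma>" "f p = p" "\<forall>x\<in>N. f x \<in> N \<and> g (f x) = g x" "x \<in> N" for f x
      using swap[of x "f x" f] 1 that by (metis IntI subsetD)
    thus ?thesis by (intro exI[of _ g] conjI ballI impI) simp_all
  next
    case 2
    have "card (N - {w}) \<le> 1" using N 2 by (simp add: card_Diff_singleton)
    hence "N - {w} = {} \<or> (\<exists>w'. N - {w} = {w'})"
      using N(2) by (auto simp: le_Suc_eq card_1_singleton_iff)
    \<comment> \<open>\<open>w' = w\<close> is allowed and covers the case
      \<open>N = {w}\<close>.\<close>
    then obtain w' where w': "N = {w, w'}" using 2 by blast
    define d where "d = g(w := \<not> g w')"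
    have "f x = x" if f: "f \<in> \<Gamma>" "f p = p" "\<forall>x\<in>N. f x \<in> N \<and> d (f x) = d x" and x: "x \<in> N" for f x
    proof -
      have "f x \<in> {w, w'}" "d (f x) = d x" using f(3) x w' by blast+
      thus ?thesis using x w' by (auto simp: d_def split: if_splits)
    qed
    moreover have "\<forall>x\<in>N \<inter> D. d x = g x" using 2 by (auto simp: d_def)
    ultimately show ?thesis by (intro exI[of _ d]) blast
  qed
qed

text \<open>The coloring is subject to two constraints: colors \<open>g\<close> on \<open>D\<close>,
  and equal colors on \<open>x\<close> and \<open>mate x\<close> off the root. A mate is colored
  together with its partner; fixing the partner fixes the mate, since automorphisms commute with
  \<open>mate\<close>. By \<open>mate_nb\<close>, two different neighbors of one vertex are never
  forced to agree.\<close>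

theorem growth:
  fixes g :: "'a \<Rightarrow> bool"
  assumes a: "a \<in> V" and ab: "b \<in> nb a"
    and mate: "\<And>x. x \<in> V \<Longrightarrow> mate x \<in> V" "\<And>x. x \<in> V \<Longrightarrow> mate (mate x) = x"
      "\<And>x. x \<in> V \<Longrightarrow> mate x = x \<or> mate x \<in> nb x"
    and mate_aut: "\<And>f x. f \<in> \<Gamma> \<Longrightarrow> x \<in> V \<Longrightarrow> mate (f x) = f (mate x)"
    and mate_root: "mate a \<in> {a, b}" "mate b \<in> {a, b}"
    and mate_nb: "\<And>p w. p \<in> V \<Longrightarrow> w \<in> nb p \<Longrightarrow> mate w \<in> nb p \<Longrightarrow> mate w = w"
    and forced: "\<And>x. x \<in> D \<Longrightarrow> x \<notin> {a, b} \<Longrightarrow> mate x = x"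
    and swap: "\<And>p w w' f. p \<in> V \<Longrightarrow> w \<in> nb p \<inter> D \<Longrightarrow> w' \<in> nb p \<inter> D \<Longrightarrow> w \<notin> {a, b} \<Longrightarrow>
      w' \<notin> {a, b} \<Longrightarrow> w \<noteq> w' \<Longrightarrow> f \<in> \<Gamma> \<Longrightarrow> f p = p \<Longrightarrow> f w = w' \<Longrightarrow> g w \<noteq> g w'"
  shows "\<exists>c. (\<forall>x\<in>V \<inter> D. c x = g x) \<and> (\<forall>x\<in>V - {a, b}. c (mate x) = c x) \<and>
    (\<forall>f\<in>\<Gamma>. f a = a \<longrightarrow> f b = b \<longrightarrow> (\<forall>x\<in>V. c (f x) = c x) \<longrightarrow> (\<forall>x\<in>V. f x = x))"
proof -
  \<comment> \<open>\<open>nb p \<inter> S \<noteq> {}\<close> leaves each \<open>p\<close> at most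
    two new neighbors. Color preservation is only asked where \<open>f x \<in> S\<close>: it is not
    known beforehand that \<open>f\<close> preserves \<open>S\<close>, and colors outside
    \<open>S\<close> are still open.\<close>
  define Good where "Good S c \<longleftrightarrow> {a, b} \<subseteq> S \<and> S \<subseteq> V \<and> (\<forall>p\<in>S. nb p \<inter> S \<noteq> {}) \<and>
    (\<forall>x\<in>S. mate x \<in> S) \<and> (\<forall>x\<in>S \<inter> D. c x = g x) \<and> (\<forall>x\<in>S - {a, b}. c (mate x) = c x) \<and>
    (\<forall>f\<in>\<Gamma>. f a = a \<longrightarrow> f b = b \<longrightarrow> (\<forall>x\<in>S. f x \<in> S \<longrightarrow> c (f x) = c x) \<longrightarrow> (\<forall>x\<in>S. f x = x))"
    for S :: "'a set" and c :: "'a \<Rightarrow> bool"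
  have good_D: "{a, b} \<subseteq> S" "S \<subseteq> V" "\<And>p. p \<in> S \<Longrightarrow> nb p \<inter> S \<noteq> {}" "\<And>x. x \<in> S \<Longrightarrow> mate x \<in> S"
      "\<And>x. x \<in> S \<inter> D \<Longrightarrow> c x = g x" "\<And>x. x \<in> S - {a, b} \<Longrightarrow> c (mate x) = c x"
      "\<And>f x. f \<in> \<Gamma> \<Longrightarrow> f a = a \<Longrightarrow> f b = b \<Longrightarrow> \<forall>x\<in>S. f x \<in> S \<longrightarrow> c (f x) = c x \<Longrightarrow> x \<in> S \<Longrightarrow> f x = x"
    if "Good S c" for S c
    using that unfolding Good_def by simp_all
  have good_I: "Good S c" if "{a, b} \<subseteq> S" "S \<subseteq> V" "\<And>p. p \<in> S \<Longrightarrow> nb p \<inter> S \<noteq> {}" "\<And>x. x \<in> S \<Longrightarrow> mate x \<in> S"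
      "\<And>x. x \<in> S \<inter> D \<Longrightarrow> c x = g x" "\<And>x. x \<in> S - {a, b} \<Longrightarrow> c (mate x) = c x"
      "\<And>f x. f \<in> \<Gamma> \<Longrightarrow> f a = a \<Longrightarrow> f b = b \<Longrightarrow> \<forall>x\<in>S. f x \<in> S \<longrightarrow> c (f x) = c x \<Longrightarrow> x \<in> S \<Longrightarrow> f x = x"
    for S c
    unfolding Good_def by (intro conjI ballI impI) (rule that; assumption)+
  have b: "b \<in> V" and ba: "a \<in> nb b" using nb_subset nb_sym a ab by blast+
  have "\<exists>c. Good V c"
  proof (rule greedy_extension)
    show "Good {a, b} g" using a b ab ba mate_root by (intro good_I) auto
  next
    fix S c c' assume S: "Good S c" and eq: "\<And>x. x \<in> S \<Longrightarrow> c' x = c x"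
    show "Good S c'"
    proof (rule good_I)
      fix x assume x: "x \<in> S - {a, b}"
      show "c' (mate x) = c' x" using good_D(4,6)[OF S] x eq by simp
    next
      fix f x assume "f \<in> \<Gamma>" "f a = a" "f b = b" "\<forall>x\<in>S. f x \<in> S \<longrightarrow> c' (f x) = c' x" "x \<in> S"
      thus "f x = x" using good_D(7)[OF S, of f x] eq by simp
    qed (use good_D[OF S] eq in simp_all)
  next
    fix \<C> c assume ne: "\<C> \<noteq> {}" and ch: "subset.chain {S. Good S c} \<C>"
    have good: "Good S c" if "S \<in> \<C>" for S using ch that by (auto simp: subset.chain_def)
    show "Good (\<Union>\<C>) c"
    proof (rule good_I)
      fix f x assume f: "f \<in> \<Gamma>" "f a = a" "f b = b"
        and cf: "\<forall>x\<in>\<Union>\<C>. f x \<in> \<Union>\<C> \<longrightarrow> c (f x) = c x" and x: "x \<in> \<Union>\<C>"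
      obtain S where S: "S \<in> \<C>" "x \<in> S" using x by blast
      have "\<forall>x\<in>S. f x \<in> S \<longrightarrow> c (f x) = c x" using cf S by blast
      thus "f x = x" using good_D(7)[OF good[OF S(1)]] f S(2) by blast
    next
      show "{a, b} \<subseteq> \<Union>\<C>" using ne good_D(1)[OF good] by blast
      show "\<Union>\<C> \<subseteq> V" using good_D(2)[OF good] by blast
      show "nb p \<inter> \<Union>\<C> \<noteq> {}" if "p \<in> \<Union>\<C>" for p using good_D(3)[OF good] that by blast
      show "mate x \<in> \<Union>\<C>" if "x \<in> \<Union>\<C>" for x using good_D(4)[OF good] that by blast
      show "c x = g x" if "x \<in> \<Union>\<C> \<inter> D" for x using good_D(5)[OF good] that by blast
      show "c (mate x) = c x" if "x \<in> \<Union>\<C> - {a, b}" for x using good_D(6)[OF good] that by blast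
    qed
  next
    fix S c assume S: "Good S c" and "S \<noteq> V"
    have Sm: "mate x \<in> S" if "x \<in> S" for x using good_D(4)[OF S] that .
    have SV: "S \<subseteq> V" and abS: "a \<in> S" "b \<in> S" using good_D(1,2)[OF S] by auto
    obtain p where p: "p \<in> S" "\<not> nb p \<subseteq> S"
      using nb_connected[OF SV] abS \<open>S \<noteq> V\<close> by blast
    define N where "N = nb p - S"
    have pV: "p \<in> V" using p SV by blast
    have NV: "N \<subseteq> V" "N \<subseteq> nb p" using nb_subset pV by (auto simp: N_def)
    have "N \<subset> nb p" using good_D(3)[OF S p(1)] by (auto simp: N_def)
    hence cN: "finite N" "card N \<le> 2"
      using nb_finite[OF pV] nb_card[OF pV] psubset_card_mono[of "nb p" N] finite_subset by fastforce+
    have "\<exists>d. (\<forall>x\<in>N \<inter> D. d x = g x) \<and>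
      (\<forall>f\<in>\<Gamma>. f p = p \<longrightarrow> (\<forall>x\<in>N. f x \<in> N \<and> d (f x) = d x) \<longrightarrow> (\<forall>x\<in>N. f x = x))"
    proof (rule color_new_neighbours[OF pV NV(2) cN])
      fix w w' f assume "w \<in> N \<inter> D" "w' \<in> N \<inter> D" "w \<noteq> w'" "f \<in> \<Gamma>" "f p = p" "f w = w'"
      thus "g w \<noteq> g w'" using swap[OF pV, of w w' f] abS by (auto simp: N_def)
    qed
    then obtain d where dD: "\<And>x. x \<in> N \<inter> D \<Longrightarrow> d x = g x"
      and d: "\<And>f x. f \<in> \<Gamma> \<Longrightarrow> f p = p \<Longrightarrow> \<forall>x\<in>N. f x \<in> N \<and> d (f x) = d x \<Longrightarrow> x \<in> N \<Longrightarrow> f x = x"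
      by metis
    have Nm: "mate x = x" if "x \<in> N" "mate x \<in> N" for x
      using mate_nb[OF pV] that NV by blast
    have mS: "mate x \<notin> S" if "x \<in> N" for x
      using that Sm[of "mate x"] mate(2)[of x] NV by (auto simp: N_def)
    \<comment> \<open>On \<open>S'\<close> the last case is reached only by mates of vertices of
      \<open>N\<close>; they inherit the color of the partner.\<close>
    define c' where "c' x = (if x \<in> S then c x else if x \<in> N then d x else d (mate x))" for x
    define S' where "S' = S \<union> N \<union> mate ` N"
    have S'V: "S' \<subseteq> V" using SV NV mate(1) by (auto simp: S'_def)
    have S'm: "mate x \<in> S'" if "x \<in> S'" for x
      using that Sm mate(2) NV by (auto simp: S'_def subset_iff)
    have S'nb: "nb x \<inter> S' \<noteq> {}" if x: "x \<in> S'" for x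
    proof -
      consider "x \<in> S" | "x \<in> N" | w where "w \<in> N" "x = mate w" using x by (auto simp: S'_def)
      thus ?thesis
      proof cases
        case 1 thus ?thesis using good_D(3)[OF S, of x] by (auto simp: S'_def)
      next
        case 2 thus ?thesis using nb_sym[OF pV] p by (auto simp: N_def S'_def)
      next
        case 3
        have w: "w \<in> V" "w \<in> nb p" using 3 NV by auto
        have "p \<in> nb w" using nb_sym[OF pV w(2)] .
        moreover have "x = w \<or> w \<in> nb x" using mate(3)[OF w(1)] nb_sym[OF w(1)] 3(2) by blast
        moreover have "p \<in> S'" "w \<in> S'" using p 3 by (auto simp: S'_def)
        ultimately show ?thesis by blast
      qed
    qed
    have c'D: "c' x = g x" if x: "x \<in> S' \<inter> D" for x
    proof -
      \<comment> \<open>A prescribed vertex off the root is its own mate, so it cannot enter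
        \<open>S'\<close> merely as the mate of another vertex.\<close>
      have "x \<in> N" if xS: "x \<notin> S"
      proof (rule ccontr)
        assume "x \<notin> N"
        then obtain w where w: "w \<in> N" "x = mate w" using x xS by (auto simp: S'_def)
        have "x \<notin> {a, b}" "x \<in> D" using xS abS x by auto
        hence "mate x = x" by (intro forced)
        hence "w = x" using mate(2)[of w] w NV by auto
        thus False using w \<open>x \<notin> N\<close> by simp
      qed
      thus ?thesis using good_D(5)[OF S, of x] dD[of x] x by (cases "x \<in> S") (simp_all add: c'_def)
    qed
    have c'm: "c' (mate x) = c' x" if x: "x \<in> S' - {a, b}" for x
    proof (cases "x \<in> S")
      case True
      thus ?thesis using good_D(6)[OF S, of x] x Sm[OF True] by (simp add: c'_def)
    next
      case False
      show ?thesis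
      proof (cases "x \<in> N")
        case True
        have "x \<in> V" using True NV by blast
        show ?thesis
        proof (cases "mate x \<in> N")
          case True thus ?thesis using Nm[OF \<open>x \<in> N\<close>] by simp
        next
          case F: False
          thus ?thesis using True False mS[OF True] mate(2)[OF \<open>x \<in> V\<close>] by (simp add: c'_def)
        qed
      next
        case F: False
        then obtain w where w: "w \<in> N" "x = mate w" using x False by (auto simp: S'_def)
        hence "mate x = w" using mate(2)[of w] NV by auto
        moreover have "w \<notin> S" using w by (simp add: N_def)
        ultimately show ?thesis using False F w by (simp add: c'_def)
      qed
    qed
    have S'f: "\<forall>x\<in>S'. f x = x"
      if f: "f \<in> \<Gamma>" "f a = a" "f b = b" and cf: "\<forall>x\<in>S'. f x \<in> S' \<longrightarrow> c' (f x) = c' x" for f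
    proof -
      have "c (f x) = c x" if "x \<in> S" "f x \<in> S" for x
        using bspec[OF cf, of x] that by (simp add: S'_def c'_def)
      hence fS: "f x = x" if "x \<in> S" for x using good_D(7)[OF S f] that by blast
      \<comment> \<open>\<open>f\<close> fixes \<open>p\<close> and so maps \<open>nb p\<close> to
        itself; being injective and the identity on \<open>S\<close>, it cannot move a new neighbor
        into \<open>S\<close>.\<close>
      have fN: "f x \<in> N" if "x \<in> N" for x
      proof -
        have "f x \<in> nb p" using aut_nb[OF f(1) pV] fS[OF p(1)] that NV(2) by (metis imageI subsetD)
        moreover have "f x \<notin> S"
        proof
          assume "f x \<in> S"
          hence "f (f x) = f x" using fS by blast
          hence "f x = x" using aut_inj[OF f(1)] aut_closed[OF f(1)] that NV
            by (meson inj_onD subsetD)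
          thus False using that \<open>f x \<in> S\<close> by (simp add: N_def)
        qed
        ultimately show ?thesis by (simp add: N_def)
      qed
      have "f x \<in> N \<and> d (f x) = d x" if "x \<in> N" for x
      proof -
        have "x \<notin> S" "f x \<notin> S" using that fN[OF that] by (simp_all add: N_def)
        thus ?thesis using bspec[OF cf, of x] fN[OF that] that by (simp add: S'_def c'_def)
      qed
      hence fN: "f x = x" if "x \<in> N" for x using d[OF f(1) fS[OF p(1)]] that by blast
      have "f (mate x) = mate x" if "x \<in> N" for x
        using mate_aut[OF f(1), of x] fN[OF that] NV that by auto
      thus ?thesis using fS fN by (simp add: S'_def ball_Un)
    qed
    have "Good S' c'"
    proof (rule good_I)
      show "{a, b} \<subseteq> S'" using abS by (simp add: S'_def)
      show "f x = x" if "f \<in> \<Gamma>" "f a = a" "f b = b" "\<forall>x\<in>S'. f x \<in> S' \<longrightarrow> c' (f x) = c' x" "x \<in> S'" for f x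
        using S'f[OF that(1-4)] that(5) by (rule bspec)
    qed (fact S'V S'nb S'm c'D c'm | rule S'nb S'm c'D c'm, assumption)+
    moreover have "S \<subset> S'" using p by (auto simp: S'_def N_def)
    moreover have "\<forall>x\<in>S. c' x = c x" by (simp add: c'_def)
    ultimately show "\<exists>S' c'. S \<subset> S' \<and> Good S' c' \<and> (\<forall>x\<in>S. c' x = c x)" by blast
  qed
  then obtain c where c: "Good V c" by blast
  show ?thesis
  proof (intro exI[of _ c] conjI ballI impI)
    show "c x = g x" if "x \<in> V \<inter> D" for x using good_D(5)[OF c that] .
    show "c (mate x) = c x" if "x \<in> V - {a, b}" for x using good_D(6)[OF c that] .
    show "f x = x" if f: "f \<in> \<Gamma>" "f a = a" "f b = b" "\<forall>x\<in>V. c (f x) = c x" "x \<in> V" for f x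
    proof (rule good_D(7)[OF c f(1-3) _ f(5)])
      show "\<forall>x\<in>V. f x \<in> V \<longrightarrow> c (f x) = c x" using f(4) by blast
    qed
  qed
qed

end

subsection \<open>Branches with marked leaves\<close>

text \<open>\<open>M\<close> will consist of the leaves that carry a pendant 4-cycle. With
  \<open>aut_inverse\<close>, branches can be pulled back along automorphisms, so that maximality of
  a branch is invariant.\<close>

locale leafy_graph = nbr_graph +
  fixes M :: "'a set"
  assumes nb_degree: "x \<in> V \<Longrightarrow> card (nb x) = 1 \<or> card (nb x) = 3"
    and M_subset: "M \<subseteq> V"
    and M_leaf: "x \<in> M \<Longrightarrow> card (nb x) = 1"
    and M_aut: "f \<in> \<Gamma> \<Longrightarrow> x \<in> M \<Longrightarrow> f x \<in> M"
    and aut_inverse: "f \<in> \<Gamma> \<Longrightarrow> \<exists>h\<in>\<Gamma>. \<forall>x\<in>V. h (f x) = x"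
begin

text \<open>\<open>full k s t\<close>: the branch hanging at \<open>s\<close> on the side away from \<open>t\<close> unfolds to
  a complete binary tree of depth \<open>k\<close> with all leaves in \<open>M\<close>.\<close>

primrec full :: "nat \<Rightarrow> 'a \<Rightarrow> 'a \<Rightarrow> bool" where
  "full 0 s t \<longleftrightarrow> s \<in> M \<and> t \<in> nb s"
| "full (Suc k) s t \<longleftrightarrow> s \<in> V \<and> t \<in> nb s \<and> card (nb s) = 3 \<and> (\<forall>c\<in>nb s - {t}. full k c s)"

lemma full_nb: "full k s t \<Longrightarrow> s \<in> V \<and> t \<in> nb s"
  using M_subset by (cases k) auto

lemma full_deg_3: "full k s t \<Longrightarrow> card (nb s) = 3 \<Longrightarrow> \<exists>j. k = Suc j"
  using M_leaf by (cases k) auto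

lemma full_deg_1: "full k s t \<Longrightarrow> card (nb s) = 1 \<Longrightarrow> k = 0"
  by (cases k) auto

lemma three_neighbours:
  assumes "card (nb s) = 3" "t \<in> nb s" "t' \<in> nb s" "t \<noteq> t'"
  obtains e where "nb s = {t, t', e}" "e \<noteq> t" "e \<noteq> t'"
proof -
  have fin: "finite (nb s)" using assms(1) card.infinite by fastforce
  have "card (nb s - {t, t'}) = 1" using assms fin by (simp add: card_Diff_subset)
  then obtain e where "nb s - {t, t'} = {e}" by (auto simp: card_1_singleton_iff)
  hence "nb s = {t, t', e}" "e \<noteq> t" "e \<noteq> t'" using assms by blast+
  thus thesis by (rule that)
qed

text \<open>The depth can be read off along any descending path: members of \<open>M\<close> have
  valence 1 and inner vertices valence 3, so both readings stop at the same vertex.\<close>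

lemma full_rank: "full j s t \<Longrightarrow> full k s t \<Longrightarrow> j = k"
proof (induction j arbitrary: k s t)
  case 0
  hence "card (nb s) = 1" using M_leaf by auto
  thus ?case using full_deg_1 0 by blast
next
  case (Suc j)
  have deg: "card (nb s) = 3" "t \<in> nb s" using Suc.prems(1) by auto
  then obtain k' where k: "k = Suc k'" using full_deg_3[OF Suc.prems(2)] by blast
  have "nb s - {t} \<noteq> {}"
  proof
    assume "nb s - {t} = {}"
    hence "nb s = {t}" using deg by blast
    thus False using deg by simp
  qed
  then obtain c where "c \<in> nb s - {t}" by blast
  hence "full j c s" "full k' c s" using Suc.prems k by auto
  thus ?case using Suc.IH k by blast
qed

text \<open>The third neighbor of \<open>s\<close> lies in both branches, so the depths agree. Then
  all three neighbors are tops of equally deep branches, which makes \<open>s\<close> a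
  centre.\<close>

lemma full_two_directions:
  assumes j: "full j s t" and k: "full k s t'" and ne: "t \<noteq> t'"
  shows "\<exists>i. j = Suc i \<and> k = Suc i \<and> card (nb s) = 3 \<and> (\<forall>c\<in>nb s. full i c s)"
proof -
  have s: "s \<in> V" "t \<in> nb s" "t' \<in> nb s" using full_nb j k by auto
  have deg: "card (nb s) = 3"
    using nb_degree[OF s(1)] s ne by (auto simp: card_1_singleton_iff)
  obtain j' k' where jk: "j = Suc j'" "k = Suc k'" using full_deg_3 deg j k by blast
  obtain e where e: "nb s = {t, t', e}" "e \<noteq> t" "e \<noteq> t'" using three_neighbours[OF deg s(2,3) ne] .
  have f: "full j' t' s" "full j' e s" "full k' t s" "full k' e s" using j k jk e ne by auto
  hence "j' = k'" using full_rank by blast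
  thus ?thesis using f jk deg e by auto
qed

lemma full_rank': "full j s t \<Longrightarrow> full k s t' \<Longrightarrow> j = k"
  using full_rank full_two_directions by (metis)

lemma full_aut:
  assumes f: "f \<in> \<Gamma>"
  shows "full k s t \<Longrightarrow> full k (f s) (f t)"
proof (induction k arbitrary: s t)
  case 0
  thus ?case using M_aut[OF f] aut_nb[OF f] M_subset by auto
next
  case (Suc k)
  have s: "s \<in> V" using Suc by simp
  have "nb s \<subseteq> V" using nb_subset s .
  hence inj: "inj_on f (nb s)" using aut_inj[OF f] inj_on_subset by blast
  have "full k c (f s)" if c: "c \<in> nb (f s) - {f t}" for c
  proof -
    obtain d where "d \<in> nb s - {t}" "c = f d" using c aut_nb[OF f s] by blast
    thus ?thesis using Suc by auto
  qed
  thus ?case using Suc.prems aut_closed[OF f s] aut_nb[OF f s] card_image[OF inj] by auto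
qed

section \<open>Branches in a graph without a centre\<close>

context
  assumes no_centre: "\<And>k r. r \<in> V \<Longrightarrow> card (nb r) = 3 \<Longrightarrow> \<not> (\<forall>c\<in>nb r. full k c r)"
begin

text \<open>By \<open>full_two_directions\<close>, a top with two directions would be a centre. So a
  top determines its depth and the vertex above it, and an automorphism fixing a top fixes the
  vertex above.\<close>

lemma full_unique:
  assumes "full j s t" "full k s t'"
  shows "j = k" "t = t'"
  using full_rank' full_two_directions[of j s t k t'] no_centre full_nb assms by blast+

text \<open>Membership in \<open>U\<close> is invariant under automorphisms and \<open>s\<close> is
  the only member of \<open>U\<close> with its color, so \<open>s\<close> is fixed. By
  \<open>full_unique\<close> so is \<open>t\<close>, and \<open>growth\<close> applies to the root
  \<open>(s, t)\<close>.\<close>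

lemma distinguishing_if_maximal_branch:
  assumes st: "full k s t" and mx: "\<And>c. c \<in> nb t \<Longrightarrow> full k c t \<Longrightarrow> c = s"
  shows "\<exists>c :: 'a \<Rightarrow> bool. \<forall>f\<in>\<Gamma>. (\<forall>x\<in>V. c (f x) = c x) \<longrightarrow> (\<forall>x\<in>V. f x = x)"
proof -
  define U where "U = {s. \<exists>t. full k s t \<and> (\<forall>c\<in>nb t. full k c t \<longrightarrow> c = s)}"
  define g where "g x \<longleftrightarrow> x = s" for x
  have s: "s \<in> V" "t \<in> nb s" using full_nb[OF st] by auto
  have UV: "U \<subseteq> V" using full_nb by (auto simp: U_def)
  have sU: "s \<in> U" using st mx by (auto simp: U_def)
  have "\<exists>c. (\<forall>x\<in>V \<inter> (insert t U). c x = g x) \<and> (\<forall>x\<in>V - {s, t}. c x = c x) \<and>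
    (\<forall>f\<in>\<Gamma>. f s = s \<longrightarrow> f t = t \<longrightarrow> (\<forall>x\<in>V. c (f x) = c x) \<longrightarrow> (\<forall>x\<in>V. f x = x))"
  proof (rule growth[OF s, where mate = "\<lambda>x. x"])
    fix p w w' f
    assume p: "p \<in> V" and w: "w \<in> nb p \<inter> insert t U" "w' \<in> nb p \<inter> insert t U" "w \<notin> {s, t}"
      "w' \<notin> {s, t}" "w \<noteq> w'" and f: "f \<in> \<Gamma>" "f p = p" "f w = w'"
    obtain q where q: "full k w q" "\<And>c. c \<in> nb q \<Longrightarrow> full k c q \<Longrightarrow> c = w"
      using w by (auto simp: U_def)
    have pw: "p \<in> nb w" using nb_sym[OF p] w by auto
    \<comment> \<open>No \<open>f\<close> fixing \<open>p\<close> carries \<open>w\<close> to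
      \<open>w'\<close>: if \<open>w\<close> hangs at \<open>p\<close>, then \<open>w'\<close> is an
      equally deep sibling, which \<open>U\<close> excludes; otherwise the branch at
      \<open>p\<close> points to both \<open>w\<close> and \<open>w'\<close>, against
      \<open>full_unique\<close>.\<close>
    have False
    proof (cases "q = p")
      case True
      thus False using full_aut[OF f(1) q(1)] f q(2)[of w'] w by auto
    next
      case False
      have "card (nb w) = 3" using nb_degree[of w] full_nb[OF q(1)] pw False
        by (auto simp: card_1_singleton_iff)
      then obtain k' where "k = Suc k'" using full_deg_3 q(1) by blast
      hence "full k' p w" using q(1) pw False by auto
      hence "full k' p w'" using full_aut[OF f(1)] f by fastforce
      thus False using full_unique(2) \<open>full k' p w\<close> w by blast
    qed
    thus "g w \<noteq> g w'" ..
  qed auto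
  then obtain c where c: "\<forall>x\<in>V \<inter> (insert t U). c x = g x"
    and rigid: "\<forall>f\<in>\<Gamma>. f s = s \<longrightarrow> f t = t \<longrightarrow> (\<forall>x\<in>V. c (f x) = c x) \<longrightarrow> (\<forall>x\<in>V. f x = x)"
    by (elim exE conjE)
  have "\<forall>x\<in>V. f x = x" if f: "f \<in> \<Gamma>" and cf: "\<forall>x\<in>V. c (f x) = c x" for f
  proof -
    have t: "t \<in> V" using nb_subset s by blast
    have fst: "full k (f s) (f t)" using full_aut[OF f st] .
    \<comment> \<open>A branch of depth \<open>k\<close> hanging at \<open>f t\<close> is pulled
      back by the inverse \<open>h\<close>, so \<open>f s\<close> lies in \<open>U\<close>
      again.\<close>
    have "c' = f s" if c': "c' \<in> nb (f t)" "full k c' (f t)" for c'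
    proof -
      obtain d where d: "d \<in> nb t" "c' = f d" using c'(1) aut_nb[OF f t] by blast
      have "d \<in> V" using nb_subset t d by blast
      obtain h where h: "h \<in> \<Gamma>" "\<forall>x\<in>V. h (f x) = x" using aut_inverse[OF f] by blast
      have "full k d t" using full_aut[OF h(1) c'(2)] h(2) t \<open>d \<in> V\<close> d by simp
      thus ?thesis using mx d by blast
    qed
    hence "f s \<in> U" using fst by (auto simp: U_def)
    hence "c (f s) = g (f s)" "c s = g s" using c sU s UV by blast+
    hence "g (f s) = g s" using cf s by auto
    hence "f s = s" by (simp add: g_def)
    moreover have "f t = t" using fst st full_unique(2) calculation by metis
    ultimately show ?thesis using rigid f cf by blast
  qed
  thus ?thesis by blast
qed

text \<open>The graph is the union of an increasing chain of branches with tops \<open>\<sigma> n\<close>, and every automorphism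
  fixes \<open>\<sigma> n\<close> for large \<open>n\<close>. It therefore suffices to separate each \<open>\<sigma> n\<close> from its sibling.\<close>

lemma distinguishing_if_no_maximal_branch:
  assumes "M \<noteq> {}" and ext: "\<And>k s t. full k s t \<Longrightarrow> \<exists>c\<in>nb t. c \<noteq> s \<and> full k c t"
  shows "\<exists>c :: 'a \<Rightarrow> bool. \<forall>f\<in>\<Gamma>. (\<forall>x\<in>V. c (f x) = c x) \<longrightarrow> (\<forall>x\<in>V. f x = x)"
proof -
  have deg3: "card (nb t) = 3" if "t \<in> V" "x \<in> nb t" "y \<in> nb t" "x \<noteq> y" for t x y
    using nb_degree[of t] that by (auto simp: card_1_singleton_iff)
  \<comment> \<open>Two equally deep branches meeting in \<open>t\<close> form a branch of the next
    depth, pointing to the third neighbor \<open>e\<close>.\<close>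
  have up: "\<exists>d. full (Suc k) t d" if st: "full k s t" for k s t
  proof -
    have s: "s \<in> V" "t \<in> nb s" using full_nb[OF st] by auto
    hence t: "t \<in> V" "s \<in> nb t" using nb_subset nb_sym by blast+
    obtain c where c: "c \<in> nb t" "c \<noteq> s" "full k c t" using ext[OF st] by blast
    have deg: "card (nb t) = 3" using deg3 t c by blast
    obtain e where e: "nb t = {s, c, e}" "e \<noteq> s" "e \<noteq> c"
      using three_neighbours[OF deg t(2) c(1)] c(2) by metis
    have "full (Suc k) t e" using t deg e st c by auto
    thus ?thesis ..
  qed
  obtain l where l: "l \<in> M" using \<open>M \<noteq> {}\<close> by blast
  then obtain p where "p \<in> nb l" using M_leaf by (metis card_1_singletonE singletonI)
  hence "\<exists>x. full 0 (fst x) (snd x)" using l by auto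
  moreover have "\<exists>y. full (Suc n) (fst y) (snd y) \<and> fst y = snd x" if "full n (fst x) (snd x)" for x n
    using up[OF that] by auto
  ultimately have "\<exists>q. \<forall>n. full n (fst (q n)) (snd (q n)) \<and> fst (q (Suc n)) = snd (q n)"
    using dependent_nat_choice[of "\<lambda>n x. full n (fst x) (snd x)" "\<lambda>n x y. fst y = snd x"] by blast
  then obtain q where q: "\<And>n. full n (fst (q n)) (snd (q n))" "\<And>n. fst (q (Suc n)) = snd (q n)"
    by blast
  define \<sigma> where "\<sigma> n = fst (q n)" for n
  have \<sigma>: "full n (\<sigma> n) (\<sigma> (Suc n))" for n using q by (simp add: \<sigma>_def)
  have \<sigma>V: "\<sigma> n \<in> V" and \<sigma>_nb: "\<sigma> (Suc n) \<in> nb (\<sigma> n)" "\<sigma> n \<in> nb (\<sigma> (Suc n))" for n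
    using full_nb[OF \<sigma>] nb_sym by blast+
  \<comment> \<open>Siblings of \<open>\<sigma> n\<close> with a branch of the same depth. Two of
    them, together with \<open>\<sigma> n\<close>, would make \<open>\<sigma> (Suc n)\<close> a
    centre.\<close>
  define C where "C n = {x \<in> nb (\<sigma> (Suc n)). x \<noteq> \<sigma> n \<and> full n x (\<sigma> (Suc n))}" for n
  have C_unique: "x = y" if "x \<in> C n" "y \<in> C n" for x y n
  proof (rule ccontr)
    assume "x \<noteq> y"
    have xy: "x \<in> nb (\<sigma> (Suc n))" "y \<in> nb (\<sigma> (Suc n))" "x \<noteq> \<sigma> n" "y \<noteq> \<sigma> n"
      "full n x (\<sigma> (Suc n))" "full n y (\<sigma> (Suc n))" using that by (auto simp: C_def)
    have deg: "card (nb (\<sigma> (Suc n))) = 3" using deg3[OF \<sigma>V xy(1,2) \<open>x \<noteq> y\<close>] .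
    obtain e where "nb (\<sigma> (Suc n)) = {x, y, e}" using three_neighbours[OF deg xy(1,2) \<open>x \<noteq> y\<close>] .
    hence "nb (\<sigma> (Suc n)) = {x, y, \<sigma> n}" using \<sigma>_nb(2)[of n] xy by auto
    hence "\<forall>c\<in>nb (\<sigma> (Suc n)). full n c (\<sigma> (Suc n))" using xy \<sigma> by auto
    thus False using no_centre[OF \<sigma>V deg] by blast
  qed
  define D where "D = range \<sigma> \<union> (\<Union>n. C n)"
  \<comment> \<open>On \<open>D\<close> the vertices \<open>\<sigma> n\<close> get one color and
    their siblings the other.\<close>
  define g where "g x \<longleftrightarrow> x \<in> range \<sigma>" for x
  have D_full: "\<exists>i. full i x (\<sigma> (Suc i)) \<and> (x = \<sigma> i \<or> x \<in> C i)" if "x \<in> D" for x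
    using that \<sigma> by (auto simp: D_def C_def)
  have "\<exists>c. (\<forall>x\<in>V \<inter> D. c x = g x) \<and> (\<forall>x\<in>V - {\<sigma> 0, \<sigma> (Suc 0)}. c x = c x) \<and>
    (\<forall>f\<in>\<Gamma>. f (\<sigma> 0) = \<sigma> 0 \<longrightarrow> f (\<sigma> (Suc 0)) = \<sigma> (Suc 0) \<longrightarrow> (\<forall>x\<in>V. c (f x) = c x) \<longrightarrow> (\<forall>x\<in>V. f x = x))"
  proof (rule growth[OF \<sigma>V \<sigma>_nb(1), where mate = "\<lambda>x. x"])
    fix p w w' f
    assume w: "w \<in> nb p \<inter> D" "w' \<in> nb p \<inter> D" "w \<noteq> w'" and f: "f \<in> \<Gamma>" "f w = w'"
    obtain i where i: "full i w (\<sigma> (Suc i))" "w = \<sigma> i \<or> w \<in> C i" using D_full w by blast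
    obtain j where j: "full j w' (\<sigma> (Suc j))" "w' = \<sigma> j \<or> w' \<in> C j" using D_full w by blast
    \<comment> \<open>\<open>f\<close> preserves depth, so \<open>w\<close> and \<open>w'\<close>
      belong to the same index \<open>i\<close>; being different, exactly one of them is
      \<open>\<sigma> i\<close>.\<close>
    have "full i w' (f (\<sigma> (Suc i)))" using full_aut[OF f(1) i(1)] f by simp
    hence ij: "i = j" using full_unique(1) j by blast
    have range: "x = \<sigma> i" if "full i x y" "x \<in> range \<sigma>" for x y
      using that full_unique(1) \<sigma> by blast
    have "g w \<longleftrightarrow> w = \<sigma> i" "g w' \<longleftrightarrow> w' = \<sigma> i"
      using range i(1) j(1) ij by (auto simp: g_def)
    thus "g w \<noteq> g w'" using i(2) j(2) ij w(3) C_unique by blast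
  qed auto
  then obtain c where c: "\<forall>x\<in>V \<inter> D. c x = g x"
    and rigid: "\<forall>f\<in>\<Gamma>. f (\<sigma> 0) = \<sigma> 0 \<longrightarrow> f (\<sigma> (Suc 0)) = \<sigma> (Suc 0) \<longrightarrow>
      (\<forall>x\<in>V. c (f x) = c x) \<longrightarrow> (\<forall>x\<in>V. f x = x)"
    by (elim exE conjE)
  \<comment> \<open>\<open>R\<close> leads from the top of a branch to the vertex above it, and
    \<open>W\<close> collects the vertices whose ascent meets the path \<open>\<sigma>\<close>.
    \<open>W\<close> is closed under neighbors: a neighbor is either the vertex above or the top of
    a smaller branch.\<close>
  define R where "R = {(x, t). \<exists>i. full i x t}"
  define W where "W = {x \<in> V. \<exists>n K. (x, \<sigma> K) \<in> R ^^ n}"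
  have R_unique: "t = t'" if "(x, t) \<in> R" "(x, t') \<in> R" for x t t'
    using that full_unique(2) by (auto simp: R_def)
  have "W = V"
  proof (rule nb_connected)
    show "W \<subseteq> V" by (auto simp: W_def)
    have "(\<sigma> 0, \<sigma> 0) \<in> R ^^ 0" by simp
    thus "W \<noteq> {}" using \<sigma>V unfolding W_def by blast
    fix x assume "x \<in> W"
    then obtain n K where x: "x \<in> V" "(x, \<sigma> K) \<in> R ^^ n" by (auto simp: W_def)
    have \<sigma>R: "(\<sigma> K, \<sigma> (Suc K)) \<in> R" using \<sigma> by (auto simp: R_def)
    obtain t m L where t: "(x, t) \<in> R" "(t, \<sigma> L) \<in> R ^^ m"
    proof (cases n)
      case 0
      hence "x = \<sigma> K" using x by simp
      thus thesis using that[of "\<sigma> (Suc K)" "Suc K" 0] \<sigma>R by simp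
    next
      case (Suc m)
      thus thesis using x(2) relpow_Suc_D2[of x "\<sigma> K" m R] that by blast
    qed
    then obtain i where i: "full i x t" by (auto simp: R_def)
    show "nb x \<subseteq> W"
    proof
      fix y assume y: "y \<in> nb x"
      hence yV: "y \<in> V" using nb_subset x by blast
      show "y \<in> W"
      proof (cases "y = t")
        case True thus ?thesis using t yV by (auto simp: W_def)
      next
        case False
        have "card (nb x) = 3" using deg3[OF x(1) y _ False] full_nb[OF i] by blast
        then obtain j where "i = Suc j" using full_deg_3 i by blast
        hence "full j y x" using i y False by auto
        hence "(y, x) \<in> R" by (auto simp: R_def)
        hence "(y, \<sigma> K) \<in> R ^^ Suc n" using x(2) by (rule relpow_Suc_I2)
        thus ?thesis using yV unfolding W_def by blast
      qed
    qed
  qed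
  have "\<forall>x\<in>V. f x = x" if f: "f \<in> \<Gamma>" and cf: "\<forall>x\<in>V. c (f x) = c x" for f
  proof -
    have "f (\<sigma> 0) \<in> W" using \<open>W = V\<close> aut_closed[OF f \<sigma>V] by simp
    then obtain n K where K: "(f (\<sigma> 0), \<sigma> K) \<in> R ^^ n" by (auto simp: W_def)
    have f\<sigma>: "full m (f (\<sigma> m)) (f (\<sigma> (Suc m)))" for m using full_aut[OF f \<sigma>] .
    have chain: "x = f (\<sigma> m)" if "(f (\<sigma> 0), x) \<in> R ^^ m" for x m
      using that
    proof (induction m arbitrary: x)
      case (Suc m)
      then obtain y where "(f (\<sigma> 0), y) \<in> R ^^ m" "(y, x) \<in> R" by auto
      moreover have "(f (\<sigma> m), f (\<sigma> (Suc m))) \<in> R" using f\<sigma> by (auto simp: R_def)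
      ultimately show ?case using Suc.IH R_unique by blast
    qed auto
    \<comment> \<open>By \<open>chain\<close>, ascending from \<open>f (\<sigma> 0)\<close> follows
      the image of the path \<open>\<sigma>\<close>. It reaches \<open>\<sigma> K\<close> after
      \<open>n\<close> steps, and comparing depths gives \<open>n = K\<close>.\<close>
    have fn: "f (\<sigma> n) = \<sigma> K" using chain[OF K] by (rule sym)
    have "full n (\<sigma> K) (f (\<sigma> (Suc n)))" using f\<sigma>[of n] fn by simp
    hence "n = K" using \<sigma> by (rule full_unique(1))
    hence fn: "f (\<sigma> n) = \<sigma> n" using fn by simp
    \<comment> \<open>If moved, \<open>\<sigma> j\<close> would go to its sibling in
      \<open>C j\<close>, which has the other color.\<close>
    have down: "f (\<sigma> j) = \<sigma> j" if "f (\<sigma> (Suc j)) = \<sigma> (Suc j)" for j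
    proof (rule ccontr)
      assume ne: "f (\<sigma> j) \<noteq> \<sigma> j"
      have "full j (f (\<sigma> j)) (\<sigma> (Suc j))" using f\<sigma>[of j] that by simp
      moreover have "f (\<sigma> j) \<in> nb (\<sigma> (Suc j))"
        using aut_nb[OF f \<sigma>V[of "Suc j"]] \<sigma>_nb(2)[of j] that by auto
      ultimately have "f (\<sigma> j) \<in> C j" using ne by (simp add: C_def)
      hence "f (\<sigma> j) \<in> V \<inter> D" using aut_closed[OF f \<sigma>V] by (auto simp: D_def)
      moreover have "\<sigma> j \<in> V \<inter> D" using \<sigma>V by (auto simp: D_def)
      ultimately have "g (f (\<sigma> j)) = g (\<sigma> j)" using c cf \<sigma>V[of j] by metis
      then obtain i where i: "f (\<sigma> j) = \<sigma> i" by (auto simp: g_def)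
      have "full j (\<sigma> i) (f (\<sigma> (Suc j)))" using f\<sigma>[of j] i by simp
      hence "j = i" using \<sigma> by (rule full_unique(1))
      thus False using ne i by simp
    qed
    \<comment> \<open>The subtraction is truncated: from \<open>m = n\<close> on, the index stays
      0.\<close>
    have "f (\<sigma> (n - m)) = \<sigma> (n - m)" for m
    proof (induction m)
      case (Suc m)
      thus ?case using down[of "n - Suc m"] by (cases "m < n") (simp_all add: Suc_diff_Suc)
    qed (simp add: fn)
    from this[of n] have f0: "f (\<sigma> 0) = \<sigma> 0" by simp
    moreover have "f (\<sigma> (Suc 0)) = \<sigma> (Suc 0)"
    proof (rule full_unique(2))
      show "full 0 (\<sigma> 0) (f (\<sigma> (Suc 0)))" using f\<sigma>[of 0] f0 by simp
    qed (rule \<sigma>)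
    ultimately show ?thesis using rigid f cf by blast
  qed
  thus ?thesis by blast
qed

end

text \<open>Without a centre, either some branch has no sibling of its depth or every branch has
  one; each alternative has its own coloring.\<close>

theorem centre_or_distinguishing:
  assumes "M \<noteq> {}"
  obtains (centre) k r where "r \<in> V" "card (nb r) = 3" "\<And>c. c \<in> nb r \<Longrightarrow> full k c r"
  | (distinguishing) c :: "'a \<Rightarrow> bool"
    where "\<And>f x. f \<in> \<Gamma> \<Longrightarrow> \<forall>x\<in>V. c (f x) = c x \<Longrightarrow> x \<in> V \<Longrightarrow> f x = x"
proof (cases "\<exists>k r. r \<in> V \<and> card (nb r) = 3 \<and> (\<forall>c\<in>nb r. full k c r)")
  case True
  then obtain k r where "r \<in> V" "card (nb r) = 3" "\<forall>c\<in>nb r. full k c r" by (elim exE conjE)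
  thus thesis by (intro centre) auto
next
  case False
  hence no: "\<not> (\<forall>c\<in>nb r. full k c r)" if "r \<in> V" "card (nb r) = 3" for k r using that by blast
  have "\<exists>c :: 'a \<Rightarrow> bool. \<forall>f\<in>\<Gamma>. (\<forall>x\<in>V. c (f x) = c x) \<longrightarrow> (\<forall>x\<in>V. f x = x)"
  proof (cases "\<exists>k s t. full k s t \<and> (\<forall>c\<in>nb t. full k c t \<longrightarrow> c = s)")
    case True
    then obtain k s t where "full k s t" "\<forall>c\<in>nb t. full k c t \<longrightarrow> c = s" by blast
    thus ?thesis by (intro distinguishing_if_maximal_branch[OF no]) auto
  next
    case False
    show ?thesis
    proof (rule distinguishing_if_no_maximal_branch[OF no \<open>M \<noteq> {}\<close>])
      show "\<exists>c\<in>nb t. c \<noteq> s \<and> full k c t" if "full k s t" for k s t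
        using False that by blast
    qed
  qed
  then obtain c :: "'a \<Rightarrow> bool" where c: "\<forall>f\<in>\<Gamma>. (\<forall>x\<in>V. c (f x) = c x) \<longrightarrow> (\<forall>x\<in>V. f x = x)" ..
  show thesis
  proof (rule distinguishing)
    show "f x = x" if "f \<in> \<Gamma>" "\<forall>x\<in>V. c (f x) = c x" "x \<in> V" for f x
      using c[rule_format, OF that(1)] that(2,3) by blast
  qed
qed

end

section \<open>Levels around a centre\<close>

context leafy_graph
begin

text \<open>\<open>below k r x t i\<close>: descending from the centre \<open>r\<close>, the vertex \<open>x\<close> is reached from its parent \<open>t\<close>,
  and its branch has depth \<open>i\<close>.\<close>

inductive below :: "nat \<Rightarrow> 'a \<Rightarrow> 'a \<Rightarrow> 'a \<Rightarrow> nat \<Rightarrow> bool" for k r where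
  below_root: "c \<in> nb r \<Longrightarrow> below k r c r k"
| below_child: "below k r x t (Suc i) \<Longrightarrow> c \<in> nb x \<Longrightarrow> c \<noteq> t \<Longrightarrow> below k r c x i"

context
  fixes k r
  assumes r: "r \<in> V" "card (nb r) = 3" and branches: "\<And>c. c \<in> nb r \<Longrightarrow> full k c r"
begin

lemma full_centre: "t \<in> nb r \<Longrightarrow> full (Suc k) r t"
  using r branches by simp

lemma below_full: "below k r x t i \<Longrightarrow> full i x t \<and> i \<le> k"
proof (induction rule: below.induct)
  case (below_child x t i c)
  thus ?case by simp
qed (simp add: branches)

lemma below_parent_full: "below k r x t i \<Longrightarrow> \<exists>t'. full (Suc i) t t'"
proof (erule below.cases)
  fix c assume "t = r" "i = k" "c \<in> nb r"
  thus ?thesis using full_centre by blast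
next
  fix y u j assume "t = y" "i = j" "below k r y u (Suc j)"
  thus ?thesis using below_full by blast
qed

text \<open>A second direction would make the parent \<open>t\<close> the top of a branch one step
  shallower than that of \<open>x\<close>, whereas by \<open>below_parent_full\<close> the branch of
  \<open>t\<close> is one step deeper.\<close>

lemma below_unique:
  assumes b: "below k r x t i" and f: "full j x t'"
  shows "t' = t \<and> j = i"
proof -
  have fi: "full i x t" using below_full[OF b] by blast
  have ij: "j = i" using full_rank'[OF f fi] .
  moreover have "t' = t"
  proof (rule ccontr)
    assume "t' \<noteq> t"
    then obtain i' where i': "i = Suc i'" "\<forall>c\<in>nb x. full i' c x"
      using full_two_directions[OF fi f] by blast
    have "full i' t x" using i'(2) full_nb[OF fi] by blast
    moreover obtain u where "full (Suc i) t u" using below_parent_full[OF b] by blast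
    ultimately have "i' = Suc i" by (rule full_rank')
    thus False using i'(1) by simp
  qed
  ultimately show ?thesis by simp
qed

lemma below_not_root: "below k r x t i \<Longrightarrow> x \<noteq> r"
proof
  assume b: "below k r x t i" and "x = r"
  have "full i r t" "i \<le> k" using below_full[OF b] \<open>x = r\<close> by auto
  moreover have "full (Suc k) r t" using full_centre full_nb \<open>full i r t\<close> by blast
  ultimately show False using full_rank[of i r t "Suc k"] by simp
qed

text \<open>The vertices reached by descending from \<open>r\<close>, together with
  \<open>r\<close>, are closed under neighbors.\<close>

lemma below_cover:
  assumes "x \<in> V" "x \<noteq> r"
  obtains t i where "below k r x t i"
proof -
  let ?W = "insert r {x. \<exists>t i. below k r x t i}"
  have "?W = V"
  proof (rule nb_connected)
    show "?W \<subseteq> V" using r below_full full_nb by blast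
    fix x assume "x \<in> ?W"
    then consider "x = r" | t i where "below k r x t i" by blast
    thus "nb x \<subseteq> ?W"
    proof cases
      case 1
      thus ?thesis using below_root by blast
    next
      case (2 t i)
      show ?thesis
      proof
        fix y assume y: "y \<in> nb x"
        show "y \<in> ?W"
        proof (cases "y = t")
          case True
          from 2 show ?thesis unfolding True by (cases rule: below.cases) auto
        next
          case False
          have f: "full i x t" using below_full[OF 2] by blast
          have "card (nb x) \<noteq> 1" using y False full_nb[OF f] by (auto simp: card_1_singleton_iff)
          hence "card (nb x) = 3" using nb_degree full_nb[OF f] by blast
          then obtain j where "i = Suc j" using full_deg_3[OF f] by blast
          hence "below k r y x j" using below_child 2 y False by blast
          thus ?thesis by blast
        qed
      qed
    qed
  qed auto
  hence "x \<in> ?W" using assms(1) by simp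
  thus thesis using assms(2) that by blast
qed

text \<open>This keeps only what characterizes a rooted tree with all leaves equally far from the
  root: one neighbor is a step closer to \<open>r\<close>, the others are a step further
  away.\<close>

lemma centre_levels:
  obtains lev :: "'a \<Rightarrow> nat" where "lev r = 0" "\<And>y. y \<in> nb r \<Longrightarrow> lev y = 1"
    "\<And>x. x \<in> V \<Longrightarrow> x \<noteq> r \<Longrightarrow> \<exists>t\<in>nb x. lev x = Suc (lev t) \<and> (\<forall>y\<in>nb x - {t}. lev y = Suc (lev x))"
    "\<And>x. x \<in> V \<Longrightarrow> lev x \<le> Suc k" "\<And>x. x \<in> V \<Longrightarrow> card (nb x) = 1 \<Longrightarrow> x \<in> M \<and> lev x = Suc k"
proof -
  \<comment> \<open>The top of a branch of depth \<open>i\<close> gets level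
    \<open>Suc k - i\<close>: neighbors of \<open>r\<close> have \<open>i = k\<close>, leaves have
    \<open>i = 0\<close>. By \<open>below_unique\<close> the depth is well defined.\<close>
  define lev where "lev x = (if x = r then 0 else Suc k - (THE i. \<exists>t. below k r x t i))" for x
  have lev: "lev x = Suc k - i" if b: "below k r x t i" for x t i
  proof -
    have "(THE i. \<exists>t. below k r x t i) = i"
      using b below_unique[OF b] below_full by (intro the_equality) blast+
    thus ?thesis using below_not_root[OF b] by (simp add: lev_def)
  qed
  show thesis
  proof (rule that)
    show lr: "lev r = 0" by (simp add: lev_def)
    show "lev y = 1" if "y \<in> nb r" for y using lev[OF below_root[OF that]] by simp
    show "lev x \<le> Suc k" if "x \<in> V" for x by (simp add: lev_def)
    fix x assume x: "x \<in> V"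
    show "x \<in> M \<and> lev x = Suc k" if "card (nb x) = 1"
    proof -
      have "x \<noteq> r" using that r by auto
      then obtain t i where b: "below k r x t i" using below_cover[OF x] by blast
      have "full i x t" using below_full[OF b] by blast
      moreover from this have "i = 0" using full_deg_1 that by blast
      ultimately show ?thesis using lev[OF b] by simp
    qed
    assume "x \<noteq> r"
    then obtain t i where b: "below k r x t i" using below_cover[OF x] by blast
    have f: "full i x t" "i \<le> k" using below_full[OF b] by auto
    show "\<exists>t\<in>nb x. lev x = Suc (lev t) \<and> (\<forall>y\<in>nb x - {t}. lev y = Suc (lev x))"
    proof (intro bexI[of _ t] conjI ballI)
      show "t \<in> nb x" using full_nb[OF f(1)] by blast
      from b show "lev x = Suc (lev t)"
      proof (cases rule: below.cases)
        case below_root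
        thus ?thesis using lev[OF b] lr by simp
      next
        case (below_child u)
        have "Suc i \<le> k" using below_full[OF below_child(1)] by blast
        thus ?thesis using lev[OF b] lev[OF below_child(1)] by simp
      qed
      fix y assume y: "y \<in> nb x - {t}"
      have "card (nb x) \<noteq> 1" using y full_nb[OF f(1)] by (auto simp: card_1_singleton_iff)
      hence "card (nb x) = 3" using nb_degree x by blast
      then obtain j where j: "i = Suc j" using full_deg_3[OF f(1)] by blast
      hence "below k r y x j" using below_child b y by blast
      thus "lev y = Suc (lev x)" using lev[OF b] lev[of y x j] j f by simp
    qed
  qed
qed

end
end

subsection \<open>Vertices of valence 2\<close>

text \<open>A walk cannot leave a set closed under neighbors. This is the form in which
  connectedness is used.\<close>

lemma connected_graph_closed:
  assumes "connected_graph G" "S \<subseteq> verts G" "S \<noteq> {}" "\<And>x. x \<in> S \<Longrightarrow> neighbors G x \<subseteq> S"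
  shows "S = verts G"
proof -
  have walk: "walk G xs \<Longrightarrow> hd xs \<in> S \<Longrightarrow> set xs \<subseteq> S" for xs
  proof (induction xs rule: induct_list012)
    case (3 x y zs)
    hence "y \<in> neighbors G x" by (simp add: walk_def neighbors_def)
    hence "y \<in> S" using assms(4) 3 by auto
    moreover have "walk G (y # zs)" using 3 by (simp add: walk_def)
    ultimately show ?case using 3 by simp
  qed auto
  obtain s where s: "s \<in> S" using assms by blast
  have "v \<in> S" if v: "v \<in> verts G" for v
  proof -
    have "\<exists>xs. walk G xs \<and> hd xs = s \<and> last xs = v"
      using assms(1) v s assms(2) unfolding connected_graph_def by blast
    then obtain xs where xs: "walk G xs" "hd xs = s" "last xs = v" by blast
    have "xs \<noteq> []" using xs(1) by (simp add: walk_def)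
    thus ?thesis using walk[OF xs(1)] xs s by auto
  qed
  thus ?thesis using assms(2) by blast
qed

lemma distinguishing_number_le_2:
  fixes c :: "'a \<Rightarrow> bool"
  assumes "\<And>f. automorphism G f \<Longrightarrow> (\<And>v. v \<in> verts G \<Longrightarrow> c (f v) = c v) \<Longrightarrow> \<forall>v\<in>verts G. f v = v"
  shows "distinguishing_number G \<le> 2"
proof -
  define d :: "'a \<Rightarrow> nat" where "d v = (if c v then 1 else 0)" for v
  have "distinguishing G d"
    unfolding distinguishing_def
  proof (intro allI impI)
    fix f assume "automorphism G f" "\<forall>v\<in>verts G. d (f v) = d v"
    thus "\<forall>v\<in>verts G. f v = v"
      by (intro assms) (auto simp: d_def split: if_splits)
  qed
  moreover have "d ` verts G \<subseteq> {..<2}" by (auto simp: d_def)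
  ultimately have "distinguishing_number G \<le> enat 2"
    unfolding distinguishing_number_def by (intro Inf_lower) blast
  thus ?thesis by (simp add: numeral_eq_enat)
qed

locale type2_graph =
  fixes G :: "'a sgraph"
  assumes simple: "simple_graph G" and connected: "connected_graph G"
    and max_valence: "max_valence G 3"
    and no_type1: "\<And>v. v \<in> verts G \<Longrightarrow> valence G v = 2 \<Longrightarrow> vertex_type G v \<noteq> 1"
begin

abbreviation "V \<equiv> verts G"
abbreviation "N \<equiv> neighbors G"
abbreviation "Aut \<equiv> {f. automorphism G f}"

lemma edge_iff: "{x, y} \<in> edges G \<longleftrightarrow> y \<in> N x"
  using simple unfolding simple_graph_def neighbors_def by fastforce

lemma N_subset: "N x \<subseteq> V"
  by (auto simp: neighbors_def)

lemma N_sym: "y \<in> N x \<Longrightarrow> x \<in> N y"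
  using edge_iff by (metis insert_commute)

lemma N_irrefl: "x \<notin> N x"
  using simple unfolding simple_graph_def neighbors_def by fastforce

lemma N_finite: "x \<in> V \<Longrightarrow> finite (N x)" and N_card: "x \<in> V \<Longrightarrow> card (N x) \<le> 3"
  using max_valence by (auto simp: max_valence_def valence_def)

lemmas N_closed = connected_graph_closed[OF connected]

lemma aut_V: "automorphism G f \<Longrightarrow> x \<in> V \<Longrightarrow> f x \<in> V"
  and aut_inj: "automorphism G f \<Longrightarrow> inj_on f V"
  and aut_image: "automorphism G f \<Longrightarrow> f ` V = V"
  by (auto simp: automorphism_def graph_iso_def bij_betw_def)

lemma aut_N:
  assumes f: "automorphism G f" and x: "x \<in> V"
  shows "N (f x) = f ` N x"
proof -
  have *: "f y \<in> N (f x) \<longleftrightarrow> y \<in> N x" if "y \<in> V" for y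
    using f x that unfolding automorphism_def graph_iso_def edge_iff by blast
  show ?thesis
  proof (intro equalityI subsetI)
    fix z assume z: "z \<in> N (f x)"
    then obtain y where "y \<in> V" "z = f y" using aut_image[OF f] N_subset by blast
    thus "z \<in> f ` N x" using * z by blast
  next
    fix z assume "z \<in> f ` N x"
    thus "z \<in> N (f x)" using * N_subset by blast
  qed
qed

lemma aut_card_N:
  assumes f: "automorphism G f" and x: "x \<in> V"
  shows "card (N (f x)) = card (N x)"
  unfolding aut_N[OF f x] by (rule card_image) (use aut_inj[OF f] N_subset inj_on_subset in blast)

lemma aut_inverse:
  assumes f: "automorphism G f"
  obtains h where "automorphism G h" "\<And>x. x \<in> V \<Longrightarrow> h (f x) = x" "\<And>x. x \<in> V \<Longrightarrow> f (h x) = x"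
proof
  let ?h = "inv_into V f"
  have bij: "bij_betw f V V" using f by (simp add: automorphism_def graph_iso_def)
  show inv: "?h (f x) = x" "f (?h x) = x" if "x \<in> V" for x
    using bij that by (simp_all add: bij_betw_def f_inv_into_f)
  have hbij: "bij_betw ?h V V" using bij by (rule bij_betw_inv_into)
  have "{u, v} \<in> edges G \<longleftrightarrow> {?h u, ?h v} \<in> edges G" if uv: "u \<in> V" "v \<in> V" for u v
  proof -
    have "?h u \<in> V" "?h v \<in> V" using hbij uv by (auto simp: bij_betw_def)
    hence "{?h u, ?h v} \<in> edges G \<longleftrightarrow> {f (?h u), f (?h v)} \<in> edges G"
      using f by (simp add: automorphism_def graph_iso_def)
    thus ?thesis using inv uv by simp
  qed
  thus "automorphism G ?h" using hbij by (simp add: automorphism_def graph_iso_def)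
qed

text \<open>\<open>V3\<close> consists of the vertices of valence 3 and 1.\<close>

definition V2 :: "'a set" where "V2 = {x \<in> V. card (N x) = 2}"
definition V3 :: "'a set" where "V3 = V - V2"

lemma V2_subset: "V2 \<subseteq> V" and V3_subset: "V3 \<subseteq> V"
  by (auto simp: V2_def V3_def)

lemma V2_E:
  assumes "x \<in> V2" "u \<in> N x"
  obtains v where "N x = {u, v}" "u \<noteq> v"
proof -
  have "card (N x) = 2" using assms by (simp add: V2_def)
  then obtain a b where "N x = {a, b}" "a \<noteq> b" by (auto simp: card_2_iff)
  thus thesis using that assms by (cases "u = a") auto
qed

lemma aut_V2: "automorphism G f \<Longrightarrow> x \<in> V \<Longrightarrow> f x \<in> V2 \<longleftrightarrow> x \<in> V2"
  using aut_card_N aut_V by (simp add: V2_def)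

lemma aut_V3: "automorphism G f \<Longrightarrow> x \<in> V \<Longrightarrow> f x \<in> V3 \<longleftrightarrow> x \<in> V3"
  using aut_V2 aut_V by (simp add: V3_def)

text \<open>If no automorphism fixing \<open>x\<close> exchanged \<open>u\<close> and
  \<open>v\<close>, all of them would restrict to the identity on \<open>N x\<close>, and
  \<open>x\<close> would have type 1.\<close>

lemma flip:
  assumes x: "x \<in> V2" and uv: "N x = {u, v}" "u \<noteq> v"
  obtains f where "automorphism G f" "f x = x" "f u = v" "f v = u"
proof -
  have V: "x \<in> V" "u \<in> V" "v \<in> V" using V2_subset x N_subset[of x] uv by auto
  have st: "f u \<in> {u, v} \<and> f v \<in> {u, v} \<and> f u \<noteq> f v" if "f \<in> stabilizer G x" for f
  proof -
    have f: "automorphism G f" "f x = x" using that by (auto simp: stabilizer_def)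
    have "{u, v} = f ` {u, v}" using aut_N[OF f(1) V(1)] unfolding f(2) uv(1) .
    moreover have "f u \<noteq> f v" using aut_inj[OF f(1)] V uv by (auto simp: inj_on_def)
    ultimately show ?thesis by blast
  qed
  have "\<exists>f\<in>stabilizer G x. f u = v"
  proof (rule ccontr)
    assume no: "\<not> ?thesis"
    have "(\<lambda>f. restrict f (N x)) f = restrict id (N x)" if f: "f \<in> stabilizer G x" for f
      using st[OF f] no f uv by (auto intro!: restrict_ext)
    hence "(\<lambda>f. restrict f (N x)) ` stabilizer G x = (\<lambda>f. restrict id (N x)) ` stabilizer G x"
      by (intro image_cong refl)
    moreover have "id \<in> stabilizer G x"
      by (simp add: stabilizer_def automorphism_def graph_iso_def bij_betw_def)
    ultimately have "(\<lambda>f. restrict f (N x)) ` stabilizer G x = {restrict id (N x)}"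
      by (simp only: image_constant)
    hence "vertex_type G x = 1" by (simp add: vertex_type_def)
    moreover have "valence G x = 2" using x by (simp add: valence_def V2_def)
    ultimately show False using no_type1 V(1) by blast
  qed
  then obtain f where f: "f \<in> stabilizer G x" "f u = v" by blast
  thus thesis using st[OF f(1)] that[of f] by (auto simp: stabilizer_def)
qed

text \<open>By \<open>flip\<close>, both neighbors of a valence-2 vertex have the same valence.
  Valence 1 would make \<open>G\<close> a path on three vertices, and valence 2 would spread to all
  vertices; both exclude the vertex of valence 3 provided by \<open>max_valence\<close>.\<close>

lemma card_N_V2_neighbour:
  assumes x: "x \<in> V2" and u: "u \<in> N x"
  shows "card (N u) = 3"
proof -
  obtain r where r: "r \<in> V" "card (N r) = 3"
    using max_valence by (auto simp: max_valence_def valence_def)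
  have same: "card (N a) = card (N b)" if y: "y \<in> V2" "N y = {a, b}" for y a b
  proof (cases "a = b")
    case False
    obtain f where f: "automorphism G f" "f a = b" by (rule flip[OF y False])
    have "a \<in> V" using N_subset[of y] y by blast
    thus ?thesis using aut_card_N[OF f(1), of a] f(2) by simp
  qed simp
  have "u \<in> V" using N_subset u by blast
  have "card (N u) \<noteq> 0" using N_sym[OF u] N_finite[OF \<open>u \<in> V\<close>] by auto
  then consider "card (N u) = 1" | "card (N u) = 2" | "card (N u) = 3"
    using N_card[OF \<open>u \<in> V\<close>] by linarith
  thus ?thesis
  proof cases
    case 1
    obtain v where v: "N x = {u, v}" using V2_E[OF x u] by blast
    have "card (N v) = 1" using same[OF x v] 1 by simp
    moreover have "x \<in> N u" "x \<in> N v" using N_sym v by blast+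
    ultimately have N: "N u = {x}" "N v = {x}" using 1 by (auto simp: card_1_singleton_iff)
    have "{x, u, v} = V"
    proof (rule N_closed)
      show "{x, u, v} \<subseteq> V" using V2_subset x N_subset[of x] v by auto
    qed (use N v in auto)
    hence "r = x \<or> r = u \<or> r = v" using r by blast
    thus ?thesis using r N x by (auto simp: V2_def)
  next
    case 2
    \<comment> \<open>The valence-2 vertices with a neighbor of valence 2; by \<open>same\<close>,
      this set is closed under neighbors.\<close>
    let ?S = "{y \<in> V2. N y \<inter> V2 \<noteq> {}}"
    have "?S = V"
    proof (rule N_closed)
      show "?S \<subseteq> V" using V2_subset by blast
      have "u \<in> V2" using 2 \<open>u \<in> V\<close> by (simp add: V2_def)
      thus "?S \<noteq> {}" using x u by blast
      fix y assume y: "y \<in> ?S"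
      then obtain a where a: "a \<in> N y" "a \<in> V2" by blast
      obtain b where b: "N y = {a, b}" using V2_E y a by blast
      have "b \<in> V" using N_subset b by blast
      hence "b \<in> V2" using same[of y a b] b a y by (simp add: V2_def)
      moreover have "y \<in> N a" "y \<in> N b" using N_sym b by blast+
      moreover have "y \<in> V2" using y by simp
      ultimately show "N y \<subseteq> ?S" unfolding b using a(2) by blast
    qed
    hence "r \<in> V2" using r by blast
    thus ?thesis using r by (simp add: V2_def)
  qed simp
qed

lemma V2_neighbour_V3: "x \<in> V2 \<Longrightarrow> N x \<subseteq> V3"
proof
  fix u assume "x \<in> V2" "u \<in> N x"
  hence "card (N u) = 3" "u \<in> V" using card_N_V2_neighbour N_subset by blast+
  thus "u \<in> V3" by (simp add: V3_def V2_def)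
qed

text \<open>Both common neighbors have valence 3, so \<open>x\<close>, \<open>y\<close>,
  \<open>z\<close> are all their neighbors, and the five vertices are closed under
  adjacency.\<close>

lemma isomorphic_K23:
  assumes xyz: "x \<in> V2" "y \<in> V2" "z \<in> V2" "x \<noteq> y" "x \<noteq> z" "y \<noteq> z"
    and N: "N y = N x" "N z = N x"
  shows "isomorphic G (complete_bipartite 2 3)"
proof -
  have "card (N x) = 2" using xyz by (simp add: V2_def)
  then obtain u v where uv: "N x = {u, v}" "u \<noteq> v" by (auto simp: card_2_iff)
  have Nw: "N w = {x, y, z}" if w: "w \<in> {u, v}" for w
  proof -
    have "x \<in> N w" "y \<in> N w" "z \<in> N w" using N uv N_sym w by auto
    moreover have "card (N w) = 3" "finite (N w)"
      using card_N_V2_neighbour[OF xyz(1)] uv w card.infinite by fastforce+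
    moreover have "card {x, y, z} = 3" using xyz by simp
    ultimately show ?thesis by (metis card_subset_eq empty_subsetI insert_subset)
  qed
  have V: "V = {u, v, x, y, z}"
    by (rule sym, rule N_closed)
      (use Nw uv N N_subset[of x] V2_subset xyz in auto)
  have "u \<notin> N u" "v \<notin> N v" using N_irrefl by auto
  hence ne: "u \<noteq> x" "u \<noteq> y" "u \<noteq> z" "v \<noteq> x" "v \<noteq> y" "v \<noteq> z" using Nw by auto
  define f :: "'a \<Rightarrow> nat + nat" where
    "f w = (if w = u then Inl 0 else if w = v then Inl 1 else
      if w = x then Inr 0 else if w = y then Inr 1 else Inr 2)" for w
  let ?K = "complete_bipartite 2 3"
  have lt: "{..<2::nat} = {0, 1}" "{..<3::nat} = {0, 1, 2}" by auto
  have "bij_betw f V (verts ?K)"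
  proof (rule bij_betw_imageI)
    show "inj_on f V" using ne uv xyz by (auto simp: inj_on_def f_def V)
    show "f ` V = verts ?K"
      using ne uv xyz unfolding V complete_bipartite_def lt by (simp add: f_def insert_commute)
  qed
  moreover have "{a, b} \<in> edges G \<longleftrightarrow> {f a, f b} \<in> edges ?K" if "a \<in> V" "b \<in> V" for a b
  proof -
    have f: "f w \<in> Inl ` {..<2} \<longleftrightarrow> w \<in> {u, v}" "f w \<in> Inr ` {..<3} \<longleftrightarrow> w \<in> {x, y, z}" if "w \<in> V" for w
      using that ne unfolding V lt by (auto simp: f_def)
    have "{f a, f b} \<in> edges ?K \<longleftrightarrow> f a \<in> Inl ` {..<2} \<and> f b \<in> Inr ` {..<3} \<or>
        f a \<in> Inr ` {..<3} \<and> f b \<in> Inl ` {..<2}"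
      unfolding complete_bipartite_def by (auto simp: doubleton_eq_iff)
    also have "\<dots> \<longleftrightarrow> a \<in> {u, v} \<and> b \<in> {x, y, z} \<or> a \<in> {x, y, z} \<and> b \<in> {u, v}"
      using f that by simp
    also have "\<dots> \<longleftrightarrow> b \<in> N a"
    proof (cases "a \<in> {u, v}")
      case True
      hence "a \<notin> {x, y, z}" using ne by blast
      thus ?thesis using True Nw[OF True] by blast
    next
      case False
      hence a: "a \<in> {x, y, z}" using that V by blast
      hence "N a = {u, v}" using N uv by blast
      thus ?thesis using a False by blast
    qed
    finally show ?thesis using edge_iff by simp
  qed
  ultimately show ?thesis unfolding isomorphic_def graph_iso_def by blast
qed

end

subsection \<open>Twins\<close>

locale type2_graph_no_triple = type2_graph +
  assumes no_triple: "x \<in> V2 \<Longrightarrow> y \<in> V2 \<Longrightarrow> z \<in> V2 \<Longrightarrow> N y = N x \<Longrightarrow> N z = N x \<Longrightarrow> x = y \<or> x = z \<or> y = z"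
begin

definition single :: "'a set" where "single = {x \<in> V2. \<forall>y\<in>V2. N y = N x \<longrightarrow> y = x}"

text \<open>\<open>twin_choice\<close> contains exactly one vertex of each pair of twins; coloring it separately makes
  every color-preserving automorphism that fixes the common neighbors of twins fix the twins too.\<close>

definition twin_choice :: "'a set" where
  "twin_choice = {x \<in> V2. (SOME y. y \<in> V2 \<and> N y = N x) = x}"

text \<open>The choice depends only on the neighborhood, so twins share it, and by
  \<open>no_triple\<close> it falls on one of the two.\<close>

lemma twin_choice_iff:
  assumes "x \<in> V2" "y \<in> V2" "N y = N x" "x \<noteq> y"
  shows "x \<in> twin_choice \<longleftrightarrow> y \<notin> twin_choice"
proof -
  let ?r = "SOME z. z \<in> V2 \<and> N z = N x"
  have "?r \<in> V2 \<and> N ?r = N x" by (rule someI) (use assms in blast)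
  hence "?r = x \<or> ?r = y" using no_triple assms by metis
  thus ?thesis using assms by (auto simp: twin_choice_def)
qed

lemma twinE:
  assumes "x \<in> V2" "x \<notin> single"
  obtains y where "y \<in> V2" "N y = N x" "y \<noteq> x"
  using assms by (auto simp: single_def)

lemma aut_single:
  assumes f: "automorphism G f" and x: "x \<in> single"
  shows "f x \<in> single"
proof -
  have xV: "x \<in> V" "x \<in> V2" using x V2_subset by (auto simp: single_def)
  obtain h where h: "automorphism G h" "\<And>x. x \<in> V \<Longrightarrow> h (f x) = x" "\<And>x. x \<in> V \<Longrightarrow> f (h x) = x"
    using aut_inverse[OF f] by blast
  have "y = f x" if y: "y \<in> V2" "N y = N (f x)" for y
  proof -
    have yV: "y \<in> V" using y V2_subset by blast
    have "N (h y) = h ` N (f x)" using aut_N[OF h(1) yV] y by simp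
    also have "\<dots> = N (h (f x))" using aut_N[OF h(1)] aut_V[OF f xV(1)] by blast
    finally have "N (h y) = N x" using h(2) xV by simp
    moreover have "h y \<in> V2" using aut_V2[OF h(1) yV] y by blast
    ultimately have "h y = x" using x by (simp add: single_def)
    thus ?thesis using h(3)[OF yV] by simp
  qed
  moreover have "f x \<in> V2" using aut_V2[OF f] xV by blast
  ultimately show ?thesis by (simp add: single_def)
qed

text \<open>Reduction to \<open>V3\<close>: once \<open>V3\<close> is fixed, a valence-2 vertex can
  only move to its twin, which \<open>twin_choice\<close> prevents. The colors of the twinless
  vertices single out \<open>z\<close>.\<close>

lemma distinguishing_number_le_2_if_V3_fixed:
  fixes c :: "'a \<Rightarrow> bool"
  assumes c: "\<And>f. automorphism G f \<Longrightarrow> (\<And>x. x \<in> V3 \<Longrightarrow> c (f x) = c x) \<Longrightarrow>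
    (\<And>x. x \<in> single \<Longrightarrow> f x = z \<longleftrightarrow> x = z) \<Longrightarrow> \<forall>x\<in>V3. f x = x"
  shows "distinguishing_number G \<le> 2"
proof (rule distinguishing_number_le_2)
  let ?c = "\<lambda>x. if x \<in> V3 then c x else if x \<in> single then x = z else x \<in> twin_choice"
  fix f assume f: "automorphism G f" and pres: "\<And>v. v \<in> V \<Longrightarrow> ?c (f v) = ?c v"
  have single2: "single \<subseteq> V2" by (auto simp: single_def)
  have fix3: "\<forall>x\<in>V3. f x = x"
  proof (rule c[OF f])
    fix x assume x: "x \<in> V3"
    hence "x \<in> V" "f x \<in> V3" using V3_subset aut_V3[OF f] by blast+
    thus "c (f x) = c x" using pres[of x] x by simp
  next
    fix x assume x: "x \<in> single"
    have "x \<in> V" "x \<notin> V3" "f x \<in> single" "f x \<notin> V3"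
      using x aut_single[OF f x] single2 V2_subset by (auto simp: V3_def)
    thus "f x = z \<longleftrightarrow> x = z" using pres[of x] x by simp
  qed
  show "\<forall>x\<in>V. f x = x"
  proof
    fix x assume x: "x \<in> V"
    show "f x = x"
    proof (cases "x \<in> V3")
      case True thus ?thesis using fix3 by blast
    next
      case False
      hence x2: "x \<in> V2" "f x \<in> V2" using x aut_V2[OF f x] by (auto simp: V3_def)
      have "f ` N x = id ` N x" using fix3 V2_neighbour_V3[OF x2(1)] by (intro image_cong) auto
      hence Nf: "N (f x) = N x" using aut_N[OF f x] by simp
      show ?thesis
      proof (rule ccontr)
        assume ne: "f x \<noteq> x"
        have "x \<notin> single" "f x \<notin> single" using ne Nf x2 by (auto simp: single_def)
        moreover have "f x \<notin> V3" using x2 by (simp add: V3_def)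
        ultimately have "f x \<in> twin_choice \<longleftrightarrow> x \<in> twin_choice" using pres[OF x] False by simp
        thus False using twin_choice_iff[OF x2 Nf ne[symmetric]] by blast
      qed
    qed
  qed
qed

text \<open>The graph on \<open>V3\<close> obtained by suppressing the vertices of valence 2.\<close>

definition nbH :: "'a \<Rightarrow> 'a set" where
  "nbH p = {q \<in> V3. q \<noteq> p \<and> (q \<in> N p \<or> (\<exists>w\<in>V2. N w = {p, q}))}"

lemma nbH_finite: "p \<in> V3 \<Longrightarrow> finite (nbH p)" and nbH_card: "p \<in> V3 \<Longrightarrow> card (nbH p) \<le> 3"
proof -
  assume p: "p \<in> V3"
  \<comment> \<open>\<open>g\<close> sends a neighbor of \<open>p\<close> in \<open>G\<close> to the
    vertex of \<open>V3\<close> it leads to, possibly through a valence-2 vertex; so suppression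
    does not increase the valence.\<close>
  define g where "g w = (if w \<in> V2 then SOME q. N w = {p, q} else w)" for w
  have pV: "p \<in> V" using p V3_subset by blast
  have sub: "nbH p \<subseteq> g ` N p"
  proof
    fix q assume "q \<in> nbH p"
    then consider "q \<in> V3" "q \<in> N p" | w where "w \<in> V2" "N w = {p, q}" "q \<noteq> p" by (auto simp: nbH_def)
    thus "q \<in> g ` N p"
    proof cases
      case 1
      hence "g q = q" by (simp add: g_def V3_def)
      thus ?thesis using 1 by (metis imageI)
    next
      case 2
      have "(SOME q'. N w = {p, q'}) = q" using 2 by (intro some_equality) (auto simp: doubleton_eq_iff)
      hence "g w = q" using 2 by (simp add: g_def)
      moreover have "w \<in> N p" using 2 N_sym[of p w] by simp
      ultimately show ?thesis by blast
    qed
  qed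
  show "finite (nbH p)" using sub N_finite[OF pV] finite_surj by blast
  have "card (nbH p) \<le> card (g ` N p)" using sub N_finite[OF pV] by (intro card_mono) auto
  also have "\<dots> \<le> card (N p)" using N_finite[OF pV] by (rule card_image_le)
  finally show "card (nbH p) \<le> 3" using N_card[OF pV] by linarith
qed

lemma aut_nbH_subset:
  assumes f: "automorphism G f" and p: "p \<in> V3"
  shows "f ` nbH p \<subseteq> nbH (f p)"
proof
  fix y assume "y \<in> f ` nbH p"
  then obtain q where q: "q \<in> nbH p" "y = f q" by blast
  have V: "p \<in> V" "q \<in> V" "q \<in> V3" using p q V3_subset by (auto simp: nbH_def)
  have "q \<noteq> p" using q by (simp add: nbH_def)
  hence "f q \<noteq> f p" using aut_inj[OF f] V by (auto simp: inj_on_def)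
  moreover have "f q \<in> V3" using aut_V3[OF f] V by blast
  moreover have "f q \<in> N (f p) \<or> (\<exists>w\<in>V2. N w = {f p, f q})"
  proof (cases "q \<in> N p")
    case True thus ?thesis using aut_N[OF f V(1)] by simp
  next
    case False
    then obtain w where w: "w \<in> V2" "N w = {p, q}" using q by (auto simp: nbH_def)
    have wV: "w \<in> V" using w V2_subset by blast
    have "N (f w) = {f p, f q}" using aut_N[OF f wV] unfolding w(2) by simp
    moreover have "f w \<in> V2" using aut_V2[OF f wV] w by blast
    ultimately show ?thesis by blast
  qed
  ultimately show "y \<in> nbH (f p)" using q(2) by (simp add: nbH_def)
qed

lemma nbr_graph_H: "nbr_graph V3 nbH Aut"
proof
  show "nbH x \<subseteq> V3" for x by (auto simp: nbH_def)
  show "finite (nbH x)" "card (nbH x) \<le> 3" if "x \<in> V3" for x using nbH_finite nbH_card that by blast+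
  show "x \<in> nbH y" if "x \<in> V3" "y \<in> nbH x" for x y
    using that N_sym by (auto simp: nbH_def insert_commute)
  show "f x \<in> V3" if "f \<in> Aut" "x \<in> V3" for f x using aut_V3 V3_subset that by blast
  show "inj_on f V3" if "f \<in> Aut" for f using aut_inj inj_on_subset V3_subset that by blast
  show "nbH (f x) = f ` nbH x" if "f \<in> Aut" "x \<in> V3" for f x
  proof
    have f: "automorphism G f" using that by simp
    have xV: "x \<in> V" using that V3_subset by blast
    show "f ` nbH x \<subseteq> nbH (f x)" using aut_nbH_subset f that by blast
    obtain h where h: "automorphism G h" "\<And>x. x \<in> V \<Longrightarrow> h (f x) = x" "\<And>x. x \<in> V \<Longrightarrow> f (h x) = x"
      using aut_inverse[OF f] by blast
    show "nbH (f x) \<subseteq> f ` nbH x"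
    proof
      fix y assume y: "y \<in> nbH (f x)"
      have "f x \<in> V3" using aut_V3[OF f xV] that by blast
      hence "h y \<in> nbH (h (f x))" using aut_nbH_subset[OF h(1)] y by blast
      hence "h y \<in> nbH x" using h(2)[OF xV] by simp
      moreover have "y = f (h y)" using h(3) y V3_subset by (auto simp: nbH_def)
      ultimately show "y \<in> f ` nbH x" by blast
    qed
  qed
  show "S = V3" if S: "S \<subseteq> V3" "S \<noteq> {}" and cl: "\<And>x. x \<in> S \<Longrightarrow> nbH x \<subseteq> S" for S
  proof -
    \<comment> \<open>Putting back the suppressed vertices between members of \<open>S\<close> gives
      a set closed under neighbors in \<open>G\<close>.\<close>
    let ?W = "S \<union> {w \<in> V2. N w \<subseteq> S}"
    have "?W = V"
    proof (rule N_closed)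
      show "?W \<subseteq> V" using S V3_subset V2_subset by blast
      show "?W \<noteq> {}" using S by blast
      fix x assume "x \<in> ?W"
      then consider "x \<in> S" | "N x \<subseteq> S" by blast
      thus "N x \<subseteq> ?W"
      proof cases
        case 1
        show ?thesis
        proof
          fix w assume w: "w \<in> N x"
          show "w \<in> ?W"
          proof (cases "w \<in> V2")
            case True
            obtain q where q: "N w = {x, q}" "x \<noteq> q" using V2_E[OF True N_sym[OF w]] by blast
            have "q \<in> V3" using V2_neighbour_V3[OF True] q by blast
            hence "q \<in> nbH x" using q True by (auto simp: nbH_def)
            hence "q \<in> S" using cl[OF 1] by blast
            hence "N w \<subseteq> S" using q 1 by simp
            thus ?thesis using True by blast
          next
            case False
            hence "w \<in> nbH x" using w N_subset[of x] N_irrefl by (auto simp: nbH_def V3_def)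
            thus ?thesis using cl[OF 1] by blast
          qed
        qed
      qed blast
    qed
    thus ?thesis using S by (auto simp: V3_def)
  qed
qed

text \<open>\<open>z\<close> is fixed as the only twinless vertex of its color, so its neighbors
  \<open>a\<close> and \<open>b\<close> are preserved as a pair; their different colors prevent an
  exchange, and they form the root.\<close>

lemma distinguishing_number_if_single:
  assumes "single \<noteq> {}"
  shows "distinguishing_number G \<le> 2"
proof -
  interpret H: nbr_graph V3 nbH Aut by (rule nbr_graph_H)
  obtain z where z: "z \<in> single" using assms by blast
  hence z2: "z \<in> V2" by (simp add: single_def)
  hence "card (N z) = 2" by (simp add: V2_def)
  then obtain a b where ab: "N z = {a, b}" "a \<noteq> b" by (auto simp: card_2_iff)
  have ab3: "a \<in> V3" "b \<in> V3" using V2_neighbour_V3[OF z2] ab by auto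
  have "b \<in> nbH a" using ab3 ab z2 by (auto simp: nbH_def)
  have "\<exists>c. (\<forall>x\<in>V3 \<inter> {a, b}. c x = (x = a)) \<and> (\<forall>x\<in>V3 - {a, b}. c x = c x) \<and>
    (\<forall>f\<in>Aut. f a = a \<longrightarrow> f b = b \<longrightarrow> (\<forall>x\<in>V3. c (f x) = c x) \<longrightarrow> (\<forall>x\<in>V3. f x = x))"
    by (rule H.growth[OF ab3(1) \<open>b \<in> nbH a\<close>, where mate = "\<lambda>x. x"]) auto
  then obtain c where c: "\<forall>x\<in>V3 \<inter> {a, b}. c x = (x = a)"
    and rigid: "\<forall>f\<in>Aut. f a = a \<longrightarrow> f b = b \<longrightarrow> (\<forall>x\<in>V3. c (f x) = c x) \<longrightarrow> (\<forall>x\<in>V3. f x = x)"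
    by (elim exE conjE)
  show ?thesis
  proof (rule distinguishing_number_le_2_if_V3_fixed)
    fix f assume f: "automorphism G f" and cf: "\<And>x. x \<in> V3 \<Longrightarrow> c (f x) = c x"
      and zf: "\<And>x. x \<in> single \<Longrightarrow> f x = z \<longleftrightarrow> x = z"
    have "f z = z" using zf[OF z] by simp
    hence "{a, b} = f ` {a, b}" using aut_N[OF f, of z] V2_subset z2 ab by auto
    moreover have "f a \<noteq> f b" using aut_inj[OF f] ab3 V3_subset ab by (auto simp: inj_on_def)
    ultimately consider "f a = a" "f b = b" | "f a = b" by (auto simp: doubleton_eq_iff)
    thus "\<forall>x\<in>V3. f x = x"
    proof cases
      case 1
      show ?thesis using rigid[rule_format, of f] f 1 cf by auto
    next
      case 2
      hence "c b = c a" using cf[OF ab3(1)] by simp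
      moreover have "c a" "\<not> c b" using c ab3 ab(2) by auto
      ultimately show ?thesis by simp
    qed
  qed
qed

end

section \<open>Pairs of twins and their common neighbors\<close>

locale type2_graph_twins = type2_graph_no_triple +
  assumes no_single: "single = {}"
begin

definition link :: "'a \<Rightarrow> 'a \<Rightarrow> bool" where "link u v \<longleftrightarrow> u \<noteq> v \<and> (\<exists>w\<in>V2. N w = {u, v})"

lemma link_sym: "link u v \<Longrightarrow> link v u"
  by (auto simp: link_def insert_commute)

lemma link_V3: "link u v \<Longrightarrow> u \<in> V3"
  using V2_neighbour_V3 by (fastforce simp: link_def)

lemma link_twins:
  assumes "link u v"
  obtains x y where "x \<in> V2" "y \<in> V2" "x \<noteq> y" "N x = {u, v}" "N y = {u, v}"
proof -
  obtain x where x: "x \<in> V2" "N x = {u, v}" using assms by (auto simp: link_def)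
  obtain y where "y \<in> V2" "N y = N x" "y \<noteq> x" using twinE[OF x(1)] no_single by blast
  thus thesis using that x by metis
qed

lemma link_if_V2: "w \<in> V2 \<Longrightarrow> u \<in> N w \<Longrightarrow> \<exists>v. link u v \<and> N w = {u, v}"
  using V2_E unfolding link_def by metis

text \<open>A link at \<open>u\<close> accounts for two twins among the neighbors of
  \<open>u\<close>; two links would require four neighbors.\<close>

lemma link_unique:
  assumes "link u v" "link u w"
  shows "v = w"
proof (rule ccontr)
  assume ne: "v \<noteq> w"
  have uV: "u \<in> V" using link_V3[OF assms(1)] V3_subset by blast
  obtain x y where xy: "x \<noteq> y" "N x = {u, v}" "N y = {u, v}" by (rule link_twins[OF assms(1)])
  obtain x' y' where xy': "x' \<noteq> y'" "N x' = {u, w}" "N y' = {u, w}" by (rule link_twins[OF assms(2)])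
  have "{u, v} \<noteq> {u, w}" using ne by (auto simp: doubleton_eq_iff)
  hence "x \<noteq> x'" "x \<noteq> y'" "y \<noteq> x'" "y \<noteq> y'" using xy xy' by auto
  hence "card {x, y, x', y'} = 4" using xy(1) xy'(1) by simp
  moreover have "{x, y, x', y'} \<subseteq> N u" using xy xy' N_sym[of u] by simp
  ultimately have "4 \<le> card (N u)" using card_mono[OF N_finite[OF uV]] by metis
  thus False using N_card[OF uV] by simp
qed

lemma aut_link:
  assumes f: "automorphism G f" and l: "link u v"
  shows "link (f u) (f v)"
proof -
  obtain w where w: "w \<in> V2" "N w = {u, v}" using l by (auto simp: link_def)
  have V: "w \<in> V" "u \<in> V" "v \<in> V" using w V2_subset N_subset[of w] by auto
  have "N (f w) = {f u, f v}" using aut_N[OF f V(1)] unfolding w(2) by simp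
  moreover have "f w \<in> V2" using aut_V2[OF f V(1)] w by blast
  moreover have "f u \<noteq> f v" using aut_inj[OF f] V l by (auto simp: inj_on_def link_def)
  ultimately show ?thesis by (auto simp: link_def)
qed

text \<open>A link that is not open belongs to a pendant 4-cycle: its ends also share a neighbor
  outside \<open>V2\<close>.\<close>

definition open_link :: "'a \<Rightarrow> 'a \<Rightarrow> bool" where
  "open_link u v \<longleftrightarrow> link u v \<and> N u \<inter> N v \<subseteq> V2"

lemma open_link_sym: "open_link u v \<Longrightarrow> open_link v u"
  using link_sym by (auto simp: open_link_def)

lemma aut_open_link:
  assumes f: "automorphism G f" and l: "open_link u v"
  shows "open_link (f u) (f v)"
proof -
  have luv: "link u v" using l by (simp add: open_link_def)
  have V: "u \<in> V" "v \<in> V" using link_V3 link_sym luv V3_subset by blast+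
  have "y \<in> V2" if y: "y \<in> N (f u)" "y \<in> N (f v)" for y
  proof -
    obtain a b where ab: "a \<in> N u" "b \<in> N v" "y = f a" "y = f b"
      using y aut_N[OF f V(1)] aut_N[OF f V(2)] by blast
    have abV: "a \<in> V" "b \<in> V" using ab N_subset by blast+
    have "a = b" using inj_onD[OF aut_inj[OF f] _ abV] ab by simp
    hence "a \<in> V2" using l ab by (auto simp: open_link_def)
    thus ?thesis using aut_V2[OF f abV(1)] ab by blast
  qed
  thus ?thesis using aut_link[OF f luv] by (auto simp: open_link_def)
qed

text \<open>\<open>THE\<close> is justified by \<open>link_unique\<close>; a vertex on no open link
  is its own mate, as \<open>growth\<close> expects of an involution.\<close>

definition mate :: "'a \<Rightarrow> 'a" where
  "mate u = (if \<exists>v. open_link u v then THE v. open_link u v else u)"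

lemma mate_eq: "open_link u v \<Longrightarrow> mate u = v"
  unfolding mate_def using link_unique by (auto simp: open_link_def intro!: the_equality)

lemma mate_cases:
  obtains "mate u = u" "\<And>v. \<not> open_link u v" | "open_link u (mate u)"
proof (cases "\<exists>v. open_link u v")
  case True
  thus thesis using mate_eq that(2) by metis
next
  case False
  thus thesis using that(1) by (simp add: mate_def)
qed

lemma aut_mate:
  assumes f: "automorphism G f" and u: "u \<in> V3"
  shows "mate (f u) = f (mate u)"
proof (cases rule: mate_cases[of u])
  case 1
  obtain h where h: "automorphism G h" "\<And>x. x \<in> V \<Longrightarrow> h (f x) = x" using aut_inverse[OF f] by blast
  have "\<not> open_link (f u) v" for v
  proof
    assume "open_link (f u) v"
    hence "open_link (h (f u)) (h v)" by (rule aut_open_link[OF h(1)])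
    thus False using 1(2) h(2) u V3_subset by auto
  qed
  thus ?thesis using 1(1) by (simp add: mate_def)
next
  case 2
  show ?thesis by (rule mate_eq[OF aut_open_link[OF f 2]])
qed

text \<open>Through \<open>mate\<close>, all open links other than the root are monochromatic. The
  root is thus the only one whose ends differ in color, and its ends are fixed.\<close>

lemma distinguishing_number_if_open_link:
  assumes ab: "open_link a b"
  shows "distinguishing_number G \<le> 2"
proof -
  interpret H: nbr_graph V3 nbH Aut by (rule nbr_graph_H)
  have link_nbH: "v \<in> nbH u" if "link u v" for u v
    using that link_V3[OF link_sym[OF that]] by (auto simp: link_def nbH_def)
  have lab: "link a b" using ab by (simp add: open_link_def)
  have a3: "a \<in> V3" "b \<in> V3" using link_V3 link_sym lab by blast+
  have ne: "a \<noteq> b" using lab by (simp add: link_def)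
  have m: "mate a = b" "mate b = a" using mate_eq ab open_link_sym by blast+
  have "\<exists>c. (\<forall>x\<in>V3 \<inter> {a, b}. c x = (x = a)) \<and> (\<forall>x\<in>V3 - {a, b}. c (mate x) = c x) \<and>
    (\<forall>f\<in>Aut. f a = a \<longrightarrow> f b = b \<longrightarrow> (\<forall>x\<in>V3. c (f x) = c x) \<longrightarrow> (\<forall>x\<in>V3. f x = x))"
  proof (rule H.growth[OF a3(1) link_nbH[OF lab]])
    fix x assume x: "x \<in> V3"
    show "mate x \<in> V3" "mate (mate x) = x" "mate x = x \<or> mate x \<in> nbH x"
    proof (atomize(full), cases rule: mate_cases[of x])
      case 1 thus "mate x \<in> V3 \<and> mate (mate x) = x \<and> (mate x = x \<or> mate x \<in> nbH x)" using x by simp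
    next
      case 2
      hence "link x (mate x)" by (simp add: open_link_def)
      thus "mate x \<in> V3 \<and> mate (mate x) = x \<and> (mate x = x \<or> mate x \<in> nbH x)"
        using mate_eq[OF open_link_sym[OF 2]] link_nbH by (auto simp: nbH_def)
    qed
  next
    show "mate (f x) = f (mate x)" if "f \<in> Aut" "x \<in> V3" for f x using aut_mate that by simp
    show "mate a \<in> {a, b}" "mate b \<in> {a, b}" using m by auto
  next
    fix p w assume p: "p \<in> V3" "w \<in> nbH p" "mate w \<in> nbH p"
    show "mate w = w"
    proof (cases rule: mate_cases[of w])
      case 2
      \<comment> \<open>If \<open>p\<close> and \<open>q\<close> were adjacent only through a
        valence-2 vertex, they would be linked, and uniqueness would give \<open>p = r\<close>. So
        \<open>p\<close> is a true common neighbor of \<open>w\<close> and \<open>mate w\<close>,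
        against openness.\<close>
      have N: "q \<in> N p" if q: "q \<in> nbH p" "r \<in> nbH p" "open_link q r" for q r
      proof (rule ccontr)
        assume "q \<notin> N p"
        then obtain x where "x \<in> V2" "N x = {p, q}" using q by (auto simp: nbH_def)
        hence "link q p" using q by (auto simp: link_def nbH_def insert_commute)
        hence "r = p" using link_unique q by (auto simp: open_link_def)
        thus False using q by (simp add: nbH_def)
      qed
      have "w \<in> N p" "mate w \<in> N p" using N p 2 open_link_sym by blast+
      hence "p \<in> N w \<inter> N (mate w)" using N_sym by blast
      hence "p \<in> V2" using 2 by (auto simp: open_link_def)
      thus ?thesis using p by (simp add: V3_def)
    qed
  qed auto
  then obtain c where c: "\<forall>x\<in>V3 \<inter> {a, b}. c x = (x = a)" "\<forall>x\<in>V3 - {a, b}. c (mate x) = c x"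
    and rigid: "\<forall>f\<in>Aut. f a = a \<longrightarrow> f b = b \<longrightarrow> (\<forall>x\<in>V3. c (f x) = c x) \<longrightarrow> (\<forall>x\<in>V3. f x = x)"
    by (elim exE conjE)
  have cab: "c a" "\<not> c b" using c(1) a3 ne by auto
  show ?thesis
  proof (rule distinguishing_number_le_2_if_V3_fixed)
    fix f assume f: "automorphism G f" and cf: "\<And>x. x \<in> V3 \<Longrightarrow> c (f x) = c x"
    have fb: "mate (f a) = f b" using aut_mate[OF f a3(1)] m by simp
    have f3: "f a \<in> V3" using aut_V3[OF f] a3 V3_subset by blast
    have col: "c (f a)" "\<not> c (f b)" using cf a3 cab by simp_all
    have "f a \<in> {a, b}"
    proof (rule ccontr)
      assume "f a \<notin> {a, b}"
      hence "c (mate (f a)) = c (f a)" using c(2) f3 by blast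
      thus False using col fb by simp
    qed
    hence fa: "f a = a" using col cab by auto
    hence "f b = b" using fb m by simp
    thus "\<forall>x\<in>V3. f x = x" using rigid[rule_format, of f] f fa cf by auto
  qed
qed

end

text \<open>All twins now sit in pendant 4-cycles.\<close>

locale type2_graph_pendant = type2_graph_twins +
  assumes no_open_link: "\<not> open_link u v"
    and V2_nonempty: "V2 \<noteq> {}"
begin

definition marked :: "'a set" where "marked = {u. \<exists>v. link u v}"

abbreviation nb3 :: "'a \<Rightarrow> 'a set" where "nb3 p \<equiv> N p \<inter> V3"

text \<open>Since no link is open, the ends share a neighbor \<open>p\<close> outside
  \<open>V2\<close>; together with the two twins it exhausts the valence of both ends.\<close>

lemma linkE:
  assumes "link u v"
  obtains p where "nb3 u = {p}" "nb3 v = {p}" "p \<in> V3"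
proof -
  obtain p where p: "p \<in> N u" "p \<in> N v" "p \<notin> V2"
    using no_open_link[of u v] assms by (auto simp: open_link_def)
  have p3: "p \<in> V3" using p N_subset by (auto simp: V3_def)
  have single: "nb3 w = {p}" if w: "link w w'" "p \<in> N w" for w w'
  proof -
    obtain x y where xy: "x \<in> V2" "y \<in> V2" "x \<noteq> y" "N x = {w, w'}" "N y = {w, w'}"
      by (rule link_twins[OF w(1)])
    have wV: "w \<in> V" using link_V3[OF w(1)] V3_subset by blast
    have "x \<in> N w" "y \<in> N w" using xy N_sym[of w] by auto
    hence sub: "{x, y, p} \<subseteq> N w" using w by blast
    have "x \<noteq> p" "y \<noteq> p" using xy(1,2) p(3) by blast+
    hence "card {x, y, p} = 3" using xy(3) by simp
    hence "{x, y, p} = N w"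
      using card_seteq[OF N_finite[OF wV] sub] N_card[OF wV] by simp
    hence "nb3 w = {x, y, p} \<inter> V3" by simp
    thus ?thesis using xy(1,2) p3 by (auto simp: V3_def)
  qed
  show thesis using that single[OF assms p(1)] single[OF link_sym[OF assms] p(2)] p3 by blast
qed

lemma nb3_unmarked:
  assumes "u \<in> V3" "u \<notin> marked"
  shows "nb3 u = N u"
proof -
  have "w \<notin> V2" if w: "w \<in> N u" for w
  proof
    assume "w \<in> V2"
    then obtain v where "link u v" using link_if_V2[OF _ N_sym[OF w]] by blast
    thus False using assms by (auto simp: marked_def)
  qed
  thus ?thesis using N_subset by (auto simp: V3_def)
qed

text \<open>Deleting the valence-2 vertices turns each pair of linked vertices into two leaves with
  a common neighbor. Connectedness is inherited from the suppressed graph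
  \<open>nbH\<close>.\<close>

lemma leafy: "leafy_graph V3 nb3 Aut marked"
proof -
  interpret H: nbr_graph V3 nbH Aut by (rule nbr_graph_H)
  show ?thesis
  proof
    show "nb3 x \<subseteq> V3" for x by blast
    show "x \<in> nb3 y" if "x \<in> V3" "y \<in> nb3 x" for x y using that N_sym by blast
    show "finite (nb3 x)" if "x \<in> V3" for x using N_finite V3_subset that by blast
    show "card (nb3 x) \<le> 3" if "x \<in> V3" for x
    proof -
      have "x \<in> V" using that V3_subset by blast
      hence "card (nb3 x) \<le> card (N x)" using N_finite by (intro card_mono) auto
      thus ?thesis using N_card[OF \<open>x \<in> V\<close>] by linarith
    qed
    show "S = V3" if S: "S \<subseteq> V3" "S \<noteq> {}" and cl: "\<And>x. x \<in> S \<Longrightarrow> nb3 x \<subseteq> S" for S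
    proof (rule H.nb_connected[OF S])
      fix x assume x: "x \<in> S"
      show "nbH x \<subseteq> S"
      proof
        fix q assume q: "q \<in> nbH x"
        show "q \<in> S"
        proof (cases "q \<in> N x")
          case True
          thus ?thesis using q cl[OF x] by (auto simp: nbH_def)
        next
          case False
          \<comment> \<open>An adjacency lost by the deletion is bypassed through the common
            neighbor \<open>p\<close>.\<close>
          hence "link x q" using q by (auto simp: nbH_def link_def)
          then obtain p where p: "nb3 x = {p}" "nb3 q = {p}" by (rule linkE)
          have "p \<in> S" using cl[OF x] p by blast
          moreover have "q \<in> nb3 p" using p(2) N_sym q by (auto simp: nbH_def)
          ultimately show ?thesis using cl by blast
        qed
      qed
    qed
    show "f x \<in> V3" if "f \<in> Aut" "x \<in> V3" for f x using aut_V3 V3_subset that by blast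
    show "inj_on f V3" if "f \<in> Aut" for f using aut_inj inj_on_subset V3_subset that by blast
    show "nb3 (f x) = f ` nb3 x" if "f \<in> Aut" "x \<in> V3" for f x
    proof -
      have f: "automorphism G f" "x \<in> V" using that V3_subset by auto
      have "f y \<in> V3 \<longleftrightarrow> y \<in> V3" if "y \<in> N x" for y using aut_V3[OF f(1)] N_subset that by blast
      thus ?thesis unfolding aut_N[OF f] by blast
    qed
    show "card (nb3 x) = 1 \<or> card (nb3 x) = 3" if x: "x \<in> V3" for x
    proof (cases "x \<in> marked")
      case True
      then obtain v where "link x v" by (auto simp: marked_def)
      then obtain p where "nb3 x = {p}" by (rule linkE)
      thus ?thesis by simp
    next
      case False
      have xV: "x \<in> V" using x V3_subset by blast
      have "N x \<noteq> {}"
      proof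
        assume "N x = {}"
        hence "{x} = V" using xV by (intro N_closed) auto
        moreover obtain w where "w \<in> V2" using V2_nonempty by blast
        ultimately show False using x V2_subset by (auto simp: V3_def)
      qed
      hence "card (N x) \<noteq> 0" using N_finite[OF xV] by simp
      moreover have "card (N x) \<noteq> 2" using x by (simp add: V3_def V2_def)
      ultimately show ?thesis using nb3_unmarked[OF x False] N_card[OF xV] by simp linarith
    qed
    show "marked \<subseteq> V3" using link_V3 by (auto simp: marked_def)
    show "card (nb3 x) = 1" if x: "x \<in> marked" for x
    proof -
      obtain v where "link x v" using x by (auto simp: marked_def)
      then obtain p where "nb3 x = {p}" by (rule linkE)
      thus ?thesis by simp
    qed
    show "f x \<in> marked" if fx: "f \<in> Aut" "x \<in> marked" for f x
    proof -
      obtain v where "link x v" using fx(2) unfolding marked_def by blast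
      hence "link (f x) (f v)" using that(1) aut_link by simp
      thus ?thesis unfolding marked_def by blast
    qed
    show "\<exists>h\<in>Aut. \<forall>x\<in>V3. h (f x) = x" if f: "f \<in> Aut" for f
    proof -
      have fa: "automorphism G f" using f by simp
      obtain h where h: "automorphism G h" "\<And>x. x \<in> V \<Longrightarrow> h (f x) = x"
        "\<And>x. x \<in> V \<Longrightarrow> f (h x) = x"
        using aut_inverse[OF fa] by blast
      have "\<forall>x\<in>V3. h (f x) = x" using h(2) V3_subset by (meson subsetD)
      thus ?thesis using h(1) by (intro bexI[of _ h]) simp_all
    qed
  qed
qed

sublocale K: leafy_graph V3 nb3 Aut marked by (rule leafy)

lemma marked_nonempty: "marked \<noteq> {}"
proof -
  obtain w where w: "w \<in> V2" using V2_nonempty by blast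
  hence "card (N w) = 2" by (simp add: V2_def)
  then obtain u v where "N w = {u, v}" by (auto simp: card_2_iff)
  hence "u \<in> N w" by simp
  then obtain v where "link u v" using link_if_V2[OF w] by blast
  thus ?thesis unfolding marked_def by blast
qed

lemma centre_or_distinguishing_number:
  obtains (centre) k r where "r \<in> V3" "card (nb3 r) = 3" "\<And>c. c \<in> nb3 r \<Longrightarrow> K.full k c r"
  | (distinguishing) "distinguishing_number G \<le> 2"
proof (rule K.centre_or_distinguishing[OF marked_nonempty])
  fix k r assume "r \<in> V3" "card (nb3 r) = 3" "\<And>c. c \<in> nb3 r \<Longrightarrow> K.full k c r"
  thus thesis by (rule centre)
next
  fix c :: "'a \<Rightarrow> bool"
  assume c: "\<And>f x. f \<in> Aut \<Longrightarrow> \<forall>x\<in>V3. c (f x) = c x \<Longrightarrow> x \<in> V3 \<Longrightarrow> f x = x"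
  have "distinguishing_number G \<le> 2"
  proof (rule distinguishing_number_le_2_if_V3_fixed)
    fix f assume "automorphism G f" "\<And>x. x \<in> V3 \<Longrightarrow> c (f x) = c x"
    thus "\<forall>x\<in>V3. f x = x" using c[of f] by simp
  qed
  thus thesis by (rule distinguishing)
qed

end

subsection \<open>Recognizing the exceptional graphs\<close>

lemma walk_join:
  assumes "walk G xs" "walk G ys" "last xs = hd ys"
  shows "walk G (xs @ tl ys) \<and> hd (xs @ tl ys) = hd xs \<and> last (xs @ tl ys) = last ys"
proof (cases ys)
  case (Cons y zs)
  thus ?thesis using assms
    by (cases zs) (auto simp: walk_def successively_append_iff)
qed (use assms in \<open>simp add: walk_def\<close>)

lemma walk_rev: "walk G xs \<Longrightarrow> walk G (rev xs)"
  by (simp add: walk_def insert_commute)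

text \<open>Recognizes a rooted tree from its levels: the conditions yield connectedness, absence of
  cycles, and \<open>lev\<close> as the distance from the root.\<close>

locale levelled_graph =
  fixes T :: "'b sgraph" and r :: 'b and lev :: "'b \<Rightarrow> nat"
  assumes simple: "simple_graph T" and root: "r \<in> verts T" and lev_root: "lev r = 0"
    and lev_root_neighbor: "y \<in> neighbors T r \<Longrightarrow> lev y = 1"
    and parent: "x \<in> verts T \<Longrightarrow> x \<noteq> r \<Longrightarrow>
      \<exists>t\<in>neighbors T x. lev x = Suc (lev t) \<and> (\<forall>y\<in>neighbors T x - {t}. lev y = Suc (lev x))"
begin

lemma edge_neighbors: "{x, y} \<in> edges T \<longleftrightarrow> y \<in> neighbors T x"
  using simple unfolding simple_graph_def neighbors_def by fastforce

lemma neighbors_sym: "y \<in> neighbors T x \<Longrightarrow> x \<in> neighbors T y"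
  using edge_neighbors by (metis insert_commute)

lemma neighbors_verts: "y \<in> neighbors T x \<Longrightarrow> y \<in> verts T"
  by (simp add: neighbors_def)

lemma lev_neighbor:
  assumes y: "y \<in> neighbors T x"
  shows "lev y \<le> Suc (lev x)"
proof (cases "x = r")
  case True
  thus ?thesis using y lev_root_neighbor by simp
next
  case False
  have "x \<in> verts T" using neighbors_verts[OF neighbors_sym[OF y]] .
  then obtain t where t: "lev x = Suc (lev t)" "\<forall>y\<in>neighbors T x - {t}. lev y = Suc (lev x)"
    using parent False by blast
  show ?thesis
  proof (cases "y = t")
    case False
    thus ?thesis using t(2) y by simp
  qed (use t(1) in simp)
qed

lemma walk_from_root:
  "x \<in> verts T \<Longrightarrow> \<exists>xs. walk T xs \<and> hd xs = r \<and> last xs = x \<and> length xs = Suc (lev x)"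
proof (induction "lev x" arbitrary: x)
  case 0
  hence "x = r" using parent[of x] by auto
  thus ?case using root lev_root by (intro exI[of _ "[r]"]) (simp add: walk_def)
next
  case (Suc n)
  hence "x \<noteq> r" using lev_root by auto
  then obtain t where t: "t \<in> neighbors T x" "lev x = Suc (lev t)" using parent Suc.prems by blast
  then obtain xs where xs: "walk T xs" "hd xs = r" "last xs = t" "length xs = Suc (lev t)"
    using Suc.hyps(1)[of t] Suc.hyps(2) neighbors_verts by auto
  have "{t, x} \<in> edges T" using edge_neighbors neighbors_sym t by blast
  hence "walk T (xs @ [x])" using xs Suc.prems by (auto simp: walk_def successively_append_iff)
  moreover have "hd (xs @ [x]) = r" using xs by (simp add: walk_def)
  ultimately show ?case using xs t by (intro exI[of _ "xs @ [x]"]) simp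
qed

text \<open>The level rises by at most one along an edge, so it bounds the distance from below;
  \<open>walk_from_root\<close> shows that the bound is attained.\<close>

lemma lev_walk: "walk T xs \<Longrightarrow> hd xs = r \<Longrightarrow> lev (last xs) < length xs"
proof (induction xs rule: rev_induct)
  case (snoc x xs)
  show ?case
  proof (cases "xs = []")
    case True
    thus ?thesis using snoc.prems lev_root by simp
  next
    case False
    hence "walk T xs" "{last xs, x} \<in> edges T" "hd xs = r"
      using snoc.prems by (auto simp: walk_def successively_append_iff)
    moreover from this have "lev x \<le> Suc (lev (last xs))" by (intro lev_neighbor) (simp add: edge_neighbors)
    ultimately show ?thesis using snoc.IH by simp
  qed
qed (simp add: walk_def)

lemma graph_dist_root: "x \<in> verts T \<Longrightarrow> graph_dist T r x = lev x"
  unfolding graph_dist_def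
proof (rule Least_equality)
  fix k assume "\<exists>xs. walk T xs \<and> hd xs = r \<and> last xs = x \<and> length xs = Suc k"
  then obtain xs where "walk T xs" "hd xs = r" "last xs = x" "length xs = Suc k" by blast
  thus "lev x \<le> k" using lev_walk[of xs] by simp
qed (rule walk_from_root)

lemma connected: "connected_graph T"
  unfolding connected_graph_def
proof (intro conjI ballI)
  show "verts T \<noteq> {}" using root by blast
  fix u v assume uv: "u \<in> verts T" "v \<in> verts T"
  obtain xs where xs: "walk T xs" "hd xs = r" "last xs = u" using walk_from_root[OF uv(1)] by blast
  obtain ys where ys: "walk T ys" "hd ys = r" "last ys = v" using walk_from_root[OF uv(2)] by blast
  have "last (rev xs) = hd ys" "hd (rev xs) = u" using xs ys by (simp_all add: last_rev hd_rev)
  thus "\<exists>zs. walk T zs \<and> hd zs = u \<and> last zs = v"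
    using walk_join[OF walk_rev[OF xs(1)] ys(1)] ys(3) by auto
qed

text \<open>A vertex of maximal level on a cycle would have both its cycle neighbors as parent.\<close>

lemma acyclic: "\<not> graph_cycle T xs"
proof
  assume c: "graph_cycle T xs"
  hence w: "walk T xs" "distinct xs" "3 \<le> length xs" "{last xs, hd xs} \<in> edges T"
    by (auto simp: graph_cycle_def)
  let ?n = "length xs"
  have step: "xs ! (Suc i mod ?n) \<in> neighbors T (xs ! i)" if i: "i < ?n" for i
  proof (cases "Suc i < ?n")
    case True
    thus ?thesis using w(1) by (simp add: walk_def successively_conv_nth edge_neighbors)
  next
    case False
    hence "i = ?n - 1" "Suc i = ?n" using i by auto
    moreover have "xs \<noteq> []" using w(3) by auto
    ultimately show ?thesis using w(4) by (simp add: last_conv_nth hd_conv_nth edge_neighbors)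
  qed
  have "finite (lev ` set xs)" "lev ` set xs \<noteq> {}" using w(3) by auto
  then obtain x where x: "x \<in> set xs" "lev x = Max (lev ` set xs)" using Max_in by (metis imageE)
  have mx: "lev y \<le> lev x" if "y \<in> set xs" for y using that x(2) by simp
  obtain i where i: "i < ?n" "xs ! i = x" using x(1) by (metis in_set_conv_nth)
  \<comment> \<open>The cyclic predecessor of \<open>i\<close>, wrapping around at 0.\<close>
  define j where "j = (if i = 0 then ?n - 1 else i - 1)"
  have j: "j < ?n" "Suc j mod ?n = i" using i w(3) by (auto simp: j_def)
  define y where "y = xs ! (Suc i mod ?n)"
  define z where "z = xs ! j"
  have "Suc i mod ?n \<noteq> j" using i w(3) by (auto simp: j_def mod_Suc)
  moreover have lt: "Suc i mod ?n < ?n" using w(3) by (intro mod_less_divisor) linarith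
  ultimately have "y \<noteq> z" using w(2) j(1) by (simp add: y_def z_def nth_eq_iff_index_eq)
  have nb: "y \<in> neighbors T x" "z \<in> neighbors T x"
    using step[OF i(1)] step[OF j(1)] neighbors_sym i j by (auto simp: y_def z_def)
  have le: "lev y \<le> lev x" "lev z \<le> lev x" using mx lt j(1) by (auto simp: y_def z_def)
  show False
  proof (cases "x = r")
    case True thus False using nb(1) lev_root_neighbor lev_root le(1) by simp
  next
    case False
    have "x \<in> verts T" using x w(1) by (auto simp: walk_def)
    then obtain t where "\<forall>y\<in>neighbors T x - {t}. lev y = Suc (lev x)" using parent False by blast
    hence "y = t" "z = t" using nb le by force+
    thus False using \<open>y \<noteq> z\<close> by simp
  qed
qed

lemma is_T:
  assumes "finite (verts T)" "\<And>x. x \<in> verts T \<Longrightarrow> valence T x = 1 \<or> valence T x = 3"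
    "\<And>x. x \<in> verts T \<Longrightarrow> valence T x = 1 \<Longrightarrow> lev x = n"
  shows "is_T n T"
proof -
  have "\<forall>v\<in>leaves T. graph_dist T r v = n"
    using assms(3) graph_dist_root by (simp add: leaves_def)
  thus ?thesis
    unfolding is_T_def tree_def using assms(1,2) simple connected acyclic root by blast
qed

end

text \<open>Each level lies in the finitely many finite neighborhoods of the previous one.\<close>

lemma finite_if_levels_bounded:
  fixes lev :: "'a \<Rightarrow> nat"
  assumes "\<And>x. x \<in> V \<Longrightarrow> finite (nb x)" "finite {x \<in> V. lev x = 0}"
    "\<And>x. x \<in> V \<Longrightarrow> lev x \<noteq> 0 \<Longrightarrow> \<exists>t\<in>V. x \<in> nb t \<and> lev x = Suc (lev t)"
    "\<And>x. x \<in> V \<Longrightarrow> lev x \<le> n"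
  shows "finite V"
proof -
  have "finite {x \<in> V. lev x = m}" for m
  proof (induction m)
    case (Suc m)
    have "{x \<in> V. lev x = Suc m} \<subseteq> (\<Union>t\<in>{x \<in> V. lev x = m}. nb t)" using assms(3) by force
    moreover have "finite (\<Union>t\<in>{x \<in> V. lev x = m}. nb t)" using Suc assms(1) by simp
    ultimately show ?case by (rule finite_subset)
  qed (rule assms(2))
  hence "finite (\<Union>m\<le>n. {x \<in> V. lev x = m})" by simp
  moreover have "V \<subseteq> (\<Union>m\<le>n. {x \<in> V. lev x = m})" using assms(4) by auto
  ultimately show ?thesis by (rule finite_subset[rotated])
qed

section \<open>Identification of \<open>R^1_n\<close>\<close>

context type2_graph_pendant
begin

text \<open>Otherwise the ends of two different links would give \<open>p\<close> four neighbors.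
  Thus the leaf pairs of the tree are exactly the links.\<close>

lemma link_if_common_leaf_neighbor:
  assumes u: "u \<in> marked" and v: "v \<in> marked" and ne: "u \<noteq> v" and p: "p \<in> nb3 u" "p \<in> nb3 v"
  shows "link u v"
proof -
  obtain u' where u': "link u u'" using u by (auto simp: marked_def)
  obtain v' where v': "link v v'" using v by (auto simp: marked_def)
  have pn: "nb3 u = {p}" "nb3 u' = {p}" "nb3 v = {p}" "nb3 v' = {p}"
    using linkE[OF u'] linkE[OF v'] p by (metis singletonD)+
  have pV: "p \<in> V" using p V3_subset by blast
  have "v = u'"
  proof (rule ccontr)
    assume "v \<noteq> u'"
    have "v' \<noteq> u" using link_unique[OF u' link_sym[of v u]] v' \<open>v \<noteq> u'\<close> by auto
    moreover have "v' \<noteq> u'" using link_unique[OF link_sym[OF u'] link_sym[of v u']] v' ne by auto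
    ultimately have "card {u, u', v, v'} = 4"
      using ne u' v' \<open>v \<noteq> u'\<close> by (auto simp: link_def)
    moreover have "{u, u', v, v'} \<subseteq> N p" using pn N_sym by blast
    ultimately have "4 \<le> card (N p)" using card_mono[OF N_finite[OF pV]] by metis
    thus False using N_card[OF pV] by simp
  qed
  thus ?thesis using u' by simp
qed

text \<open>The graph on \<open>V3\<close> is the tree. Its leaves are at distance
  \<open>Suc k\<close> from \<open>r\<close>, because branches of depth \<open>k\<close> hang at the
  neighbors of \<open>r\<close>; the twins are the vertices added by \<open>R1_of\<close>.\<close>

lemma isomorphic_R1_if_centre:
  assumes r: "r \<in> V3" "card (nb3 r) = 3" and full: "\<And>c. c \<in> nb3 r \<Longrightarrow> K.full k c r"
  shows "isomorphic_R1 G (Suc k)"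
proof -
  obtain lev where lev: "lev r = 0" "\<And>y. y \<in> nb3 r \<Longrightarrow> lev y = 1"
    "\<And>x. x \<in> V3 \<Longrightarrow> x \<noteq> r \<Longrightarrow> \<exists>t\<in>nb3 x. lev x = Suc (lev t) \<and> (\<forall>y\<in>nb3 x - {t}. lev y = Suc (lev x))"
    "\<And>x. x \<in> V3 \<Longrightarrow> lev x \<le> Suc k"
    "\<And>x. x \<in> V3 \<Longrightarrow> card (nb3 x) = 1 \<Longrightarrow> x \<in> marked \<and> lev x = Suc k"
    using K.centre_levels[OF r full] by blast
  have "finite V3"
  proof (rule finite_if_levels_bounded[OF K.nb_finite _ _ lev(4)])
    have "{x \<in> V3. lev x = 0} \<subseteq> {r}" using lev(3) by force
    thus "finite {x \<in> V3. lev x = 0}" by (rule finite_subset) simp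
    fix x assume x: "x \<in> V3" "lev x \<noteq> 0"
    hence "x \<noteq> r" using lev(1) by auto
    then obtain t where t: "t \<in> nb3 x" "lev x = Suc (lev t)" using lev(3)[OF x(1)] by blast
    have "t \<in> V3" "x \<in> nb3 t" using K.nb_sym[OF x(1) t(1)] t(1) by simp_all
    thus "\<exists>t\<in>V3. x \<in> nb3 t \<and> lev x = Suc (lev t)" using t(2) by (intro bexI[of _ t] conjI)
  qed
  \<comment> \<open>\<open>isomorphic_R1\<close> asks for a tree on \<open>nat\<close>, so the
    finite set \<open>V3\<close> is transported there.\<close>
  then obtain h :: "'a \<Rightarrow> nat" where h: "inj_on h V3"
    using finite_imp_inj_to_nat_seg[of V3] by auto
  have h_eq: "h a = h b \<longleftrightarrow> a = b" if "a \<in> V3" "b \<in> V3" for a b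
    using h that by (auto simp: inj_on_def)
  define T where "T = \<lparr>verts = h ` V3, edges = {{h p, h q} | p q. p \<in> V3 \<and> q \<in> nb3 p}\<rparr>"
  have verts_T: "verts T = h ` V3" by (simp add: T_def)
  have edge_T: "{h p, h q} \<in> edges T \<longleftrightarrow> q \<in> N p" if "p \<in> V3" "q \<in> V3" for p q
  proof
    assume "{h p, h q} \<in> edges T"
    then obtain a b where ab: "{h p, h q} = {h a, h b}" "a \<in> V3" "b \<in> nb3 a" by (auto simp: T_def)
    hence b: "b \<in> V3" "b \<in> N a" "a \<in> N b" using N_sym[of b a] by simp_all
    have "p = a \<and> q = b \<or> p = b \<and> q = a"
      using ab(1) h_eq[of _ a] h_eq[of _ b] that ab(2) b(1) by (simp add: doubleton_eq_iff)
    thus "q \<in> N p" using b(2,3) by blast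
  qed (use that in \<open>auto simp: T_def\<close>)
  have nb_T: "neighbors T (h p) = h ` nb3 p" if "p \<in> V3" for p
    using edge_T[OF that] by (auto simp: neighbors_def verts_T)
  have val_T: "valence T (h p) = card (nb3 p)" if "p \<in> V3" for p
    unfolding valence_def nb_T[OF that] by (rule card_image) (use h inj_on_subset in blast)
  define lv where "lv = lev \<circ> inv_into V3 h"
  have lv: "lv (h p) = lev p" if "p \<in> V3" for p using h that by (simp add: lv_def)
  have simple_T: "simple_graph T"
    unfolding simple_graph_def
  proof
    fix e assume "e \<in> edges T"
    then obtain p q where pq: "e = {h p, h q}" "p \<in> V3" "q \<in> nb3 p" by (auto simp: T_def)
    have "p \<noteq> q" using pq N_irrefl by blast
    hence "h p \<noteq> h q" using h_eq pq by blast
    thus "e \<subseteq> verts T \<and> card e = 2" using pq verts_T by auto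
  qed
  interpret T: levelled_graph T "h r" lv
  proof
    show "simple_graph T" by (rule simple_T)
    show "h r \<in> verts T" using r verts_T by blast
    show "lv (h r) = 0" using lv lev(1) r by simp
    show "lv y = 1" if "y \<in> neighbors T (h r)" for y
      using that nb_T[OF r(1)] lv lev(2) by auto
    fix x assume x: "x \<in> verts T" "x \<noteq> h r"
    then obtain p where p: "x = h p" "p \<in> V3" "p \<noteq> r" using verts_T by blast
    obtain t where t: "t \<in> nb3 p" "lev p = Suc (lev t)" "\<forall>y\<in>nb3 p - {t}. lev y = Suc (lev p)"
      using lev(3)[OF p(2,3)] by blast
    show "\<exists>t\<in>neighbors T x. lv x = Suc (lv t) \<and> (\<forall>y\<in>neighbors T x - {t}. lv y = Suc (lv x))"
      unfolding p(1) nb_T[OF p(2)]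
    proof (intro bexI[of _ "h t"] conjI ballI)
      show "lv (h p) = Suc (lv (h t))" using t p lv by simp
      fix y assume "y \<in> h ` nb3 p - {h t}"
      then obtain q where "q \<in> nb3 p - {t}" "y = h q" by blast
      thus "lv y = Suc (lv (h p))" using t p lv by simp
    qed (use t in blast)
  qed
  have isT: "is_T (Suc k) T"
  proof (rule T.is_T)
    show "finite (verts T)" using verts_T \<open>finite V3\<close> by simp
    fix x assume "x \<in> verts T"
    then obtain p where p: "x = h p" "p \<in> V3" using verts_T by blast
    show "valence T x = 1 \<or> valence T x = 3"
      unfolding p(1) val_T[OF p(2)] by (rule K.nb_degree[OF p(2)])
    show "lv x = Suc k" if "valence T x = 1"
      using that lev(5)[OF p(2)] unfolding p(1) val_T[OF p(2)] lv[OF p(2)] by blast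
  qed
  have leaf: "h u \<in> leaves T \<longleftrightarrow> u \<in> marked" if u: "u \<in> V3" for u
  proof -
    have "h u \<in> leaves T \<longleftrightarrow> card (nb3 u) = 1"
      using u by (simp add: leaves_def verts_T val_T)
    thus ?thesis using K.M_leaf[of u] lev(5)[OF u] by blast
  qed
  have pairs: "P \<in> leaf_pairs T \<longleftrightarrow> (\<exists>w\<in>V2. P = h ` N w)" for P
  proof
    assume "P \<in> leaf_pairs T"
    then obtain a b where ab: "P = {a, b}" "a \<in> leaves T" "b \<in> leaves T" "a \<noteq> b"
      "neighbors T a \<inter> neighbors T b \<noteq> {}" by (auto simp: leaf_pairs_def)
    obtain u v where uv: "a = h u" "b = h v" "u \<in> V3" "v \<in> V3"
      using ab verts_T by (auto simp: leaves_def)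
    hence m: "u \<in> marked" "v \<in> marked" "u \<noteq> v" using ab leaf by auto
    obtain p q where pq: "p \<in> nb3 u" "q \<in> nb3 v" "h p = h q"
      using ab(5) uv nb_T by auto
    hence "p = q" using h_eq by blast
    hence "link u v" using link_if_common_leaf_neighbor m pq by blast
    then obtain w where "w \<in> V2" "N w = {u, v}" by (auto simp: link_def)
    thus "\<exists>w\<in>V2. P = h ` N w" using ab(1) uv by (intro bexI[of _ w]) auto
  next
    assume "\<exists>w\<in>V2. P = h ` N w"
    then obtain w where w: "w \<in> V2" "P = h ` N w" by blast
    obtain u where "u \<in> N w" using w(1) V2_def by fastforce
    then obtain v where l: "link u v" "N w = {u, v}" using link_if_V2[OF w(1)] by blast
    obtain p where p: "nb3 u = {p}" "nb3 v = {p}" by (rule linkE[OF l(1)])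
    have uv: "u \<in> V3" "v \<in> V3" "u \<noteq> v" "u \<in> marked" "v \<in> marked"
      using l(1) link_sym[OF l(1)] link_V3 by (auto simp: link_def marked_def)
    hence "h u \<in> leaves T" "h v \<in> leaves T" "h u \<noteq> h v" using leaf h_eq by auto
    moreover have "neighbors T (h u) \<inter> neighbors T (h v) \<noteq> {}" using nb_T uv p by simp
    ultimately show "P \<in> leaf_pairs T" using w(2) l(2) unfolding leaf_pairs_def by auto
  qed
  \<comment> \<open>A valence-2 vertex goes to its leaf pair, and \<open>twin_choice\<close>
    supplies the Boolean: it holds for exactly one of two twins, so both new vertices of each pair
    are hit once.\<close>
  define \<phi> :: "'a \<Rightarrow> nat + nat set \<times> bool" where
    "\<phi> x = (if x \<in> V3 then Inl (h x) else Inr (h ` N x, x \<in> twin_choice))" for x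
  have \<phi>3: "\<phi> x = Inl (h x)" if "x \<in> V3" for x using that by (simp add: \<phi>_def)
  have \<phi>2: "\<phi> x = Inr (h ` N x, x \<in> twin_choice)" if "x \<in> V2" for x using that by (simp add: \<phi>_def V3_def)
  have V_split: "V = V3 \<union> V2" using V2_subset by (auto simp: V3_def)
  have N_eq: "N x = N y" if "x \<in> V2" "y \<in> V2" "h ` N x = h ` N y" for x y
    using inj_on_image_eq_iff[OF h V2_neighbour_V3 V2_neighbour_V3] that by blast
  have inj: "inj_on \<phi> V"
  proof (rule inj_onI)
    fix x y assume xy: "x \<in> V" "y \<in> V" "\<phi> x = \<phi> y"
    consider "x \<in> V3" "y \<in> V3" | "x \<in> V2" "y \<in> V2" | "x \<in> V2" "y \<in> V3" | "x \<in> V3" "y \<in> V2"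
      using xy V_split by blast
    thus "x = y"
    proof cases
      case 1 thus ?thesis using xy(3) h_eq \<phi>3 by simp
    next
      case 2
      hence "h ` N x = h ` N y" "x \<in> twin_choice \<longleftrightarrow> y \<in> twin_choice" using xy(3) \<phi>2 by simp_all
      thus ?thesis using twin_choice_iff[OF 2] N_eq[OF 2] by metis
    qed (use xy(3) \<phi>2 \<phi>3 in simp_all)
  qed
  have surj: "\<phi> ` V = verts (R1_of T)"
  proof -
    have "\<phi> ` V2 = Inr ` (leaf_pairs T \<times> UNIV)"
    proof (intro equalityI subsetI)
      fix y assume "y \<in> \<phi> ` V2"
      thus "y \<in> Inr ` (leaf_pairs T \<times> UNIV)" using \<phi>2 pairs by auto
    next
      fix y :: "nat + nat set \<times> bool" assume "y \<in> Inr ` (leaf_pairs T \<times> UNIV)"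
      then obtain w b where w: "w \<in> V2" "y = Inr (h ` N w, b)" using pairs by auto
      obtain w' where w': "w' \<in> V2" "N w' = N w" "w' \<noteq> w" using twinE[OF w(1)] no_single by blast
      have "w \<in> twin_choice \<longleftrightarrow> w' \<notin> twin_choice" using twin_choice_iff[OF w(1) w'(1,2)] w'(3) by simp
      then consider "b = (w \<in> twin_choice)" | "b = (w' \<in> twin_choice)" by blast
      thus "y \<in> \<phi> ` V2"
      proof cases
        case 1 thus ?thesis using w \<phi>2[OF w(1)] by (intro image_eqI[of _ _ w]) simp_all
      next
        case 2 thus ?thesis using w w' \<phi>2[OF w'(1)] by (intro image_eqI[of _ _ w']) simp_all
      qed
    qed
    moreover have "\<phi> ` V3 = Inl ` verts T" unfolding verts_T image_image using \<phi>3 by simp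
    ultimately show ?thesis unfolding V_split image_Un by (simp add: R1_of_def)
  qed
  have edges_R: "edges (R1_of T) = (`) Inl ` edges T \<union> {{Inl u, Inr (p, b)} | u p b. p \<in> leaf_pairs T \<and> u \<in> p}"
    by (simp add: R1_of_def)
  have mixed: "{Inl a, Inr (P, b)} \<in> edges (R1_of T) \<longleftrightarrow> P \<in> leaf_pairs T \<and> a \<in> P" for a P b
    unfolding edges_R by (auto simp: doubleton_eq_iff)
  have edge32: "{x, y} \<in> edges G \<longleftrightarrow> {\<phi> x, \<phi> y} \<in> edges (R1_of T)" if xy: "x \<in> V3" "y \<in> V2" for x y
  proof -
    have "h ` N y \<in> leaf_pairs T" using pairs xy by blast
    hence "{\<phi> x, \<phi> y} \<in> edges (R1_of T) \<longleftrightarrow> h x \<in> h ` N y" using mixed \<phi>2 \<phi>3 xy by simp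
    also have "\<dots> \<longleftrightarrow> x \<in> N y" using inj_on_image_mem_iff[OF h xy(1) V2_neighbour_V3[OF xy(2)]] .
    finally show ?thesis using edge_iff N_sym by blast
  qed
  have "{x, y} \<in> edges G \<longleftrightarrow> {\<phi> x, \<phi> y} \<in> edges (R1_of T)" if xy: "x \<in> V" "y \<in> V" for x y
  proof -
    consider "x \<in> V3" "y \<in> V3" | "x \<in> V2" "y \<in> V2" | "x \<in> V2" "y \<in> V3" | "x \<in> V3" "y \<in> V2"
      using xy V_split by blast
    thus ?thesis
    proof cases
      case 1
      let ?I = "Inl :: nat \<Rightarrow> nat + nat set \<times> bool"
      have eq: "{\<phi> x, \<phi> y} = ?I ` {h x, h y}" using 1 \<phi>3 by simp
      have no: "?I ` {h x, h y} \<notin> {{Inl u, Inr (p, b)} | u p b. p \<in> leaf_pairs T \<and> u \<in> p}"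
        by (auto simp: doubleton_eq_iff)
      have "{\<phi> x, \<phi> y} \<in> edges (R1_of T) \<longleftrightarrow> ?I ` {h x, h y} \<in> (`) ?I ` edges T"
        unfolding eq edges_R Un_iff by (simp only: no simp_thms)
      also have "\<dots> \<longleftrightarrow> {h x, h y} \<in> edges T"
        by (rule inj_image_mem_iff) (simp add: inj_def inj_image_eq_iff)
      finally show ?thesis using edge_T[OF 1] edge_iff by simp
    next
      case 2
      have "y \<notin> N x" using V2_neighbour_V3[OF 2(1)] 2(2) by (auto simp: V3_def)
      moreover have "{Inr a, Inr b} \<notin> edges (R1_of T)" for a b
        unfolding edges_R by (auto simp: doubleton_eq_iff)
      ultimately show ?thesis using edge_iff \<phi>2 2 by simp
    next
      case 3 thus ?thesis using edge32[OF 3(2,1)] by (simp add: insert_commute)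
    next
      case 4 thus ?thesis using edge32 by simp
    qed
  qed
  hence "graph_iso G (R1_of T) \<phi>" using inj surj by (simp add: graph_iso_def bij_betw_def)
  thus ?thesis using isT unfolding isomorphic_R1_def isomorphic_def by blast
qed

end

theorem theorem5p4:
  fixes G :: "'a sgraph"
  assumes "simple_graph G"
    and "connected_graph G"
    and "max_valence G 3"
    and "\<exists>v\<in>verts G. valence G v = 2 \<and> vertex_type G v = 2"
    and "\<not> (\<exists>v\<in>verts G. valence G v = 2 \<and> vertex_type G v = 1)"
  shows "isomorphic G (complete_bipartite 2 3) \<or>
         (\<exists>n\<ge>1. isomorphic_R1 G n) \<or>
         distinguishing_number G \<le> 2"
proof -
  interpret type2_graph G
    by unfold_locales (use assms in auto)
  show ?thesis
  proof (cases "\<exists>x\<in>V2. \<exists>y\<in>V2. \<exists>z\<in>V2. N y = N x \<and> N z = N x \<and> x \<noteq> y \<and> x \<noteq> z \<and> y \<noteq> z")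
    case True
    thus ?thesis using isomorphic_K23 by blast
  next
    case False
    interpret type2_graph_no_triple G
      by unfold_locales (use False in blast)
    show ?thesis
    proof (cases "single = {}")
      case True
      interpret type2_graph_twins G
        by unfold_locales (fact True)
      show ?thesis
      proof (cases "\<exists>u v. open_link u v")
        case True
        thus ?thesis using distinguishing_number_if_open_link by blast
      next
        case False
        \<comment> \<open>The given vertex of valence 2 yields \<open>V2_nonempty\<close>.\<close>
        interpret type2_graph_pendant G
          by unfold_locales (use False assms(4) in \<open>auto simp: V2_def valence_def\<close>)
        show ?thesis
        proof (rule centre_or_distinguishing_number)
          fix k r assume "r \<in> V3" "card (nb3 r) = 3" "\<And>c. c \<in> nb3 r \<Longrightarrow> K.full k c r"
          hence "isomorphic_R1 G (Suc k)" by (rule isomorphic_R1_if_centre)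
          moreover have "1 \<le> Suc k" by simp
          ultimately show ?thesis by blast
        qed blast
      qed
    next
      case False
      thus ?thesis using distinguishing_number_if_single by blast
    qed
  qed
qed

end
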